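(* Let $d\ge 2$ and let $\mathbf{r}=(r_1,\ldots,r_d)$ be a tuple with $r_i\ge 0$, $\sum_{i=1}^d r_i=1$, such that $\#\{i: r_i=\max_{1\le j\le d} r_j\}\ge d-1$. Then the set $\mathbf{Bad}(\mathbf{r})\subset\mathbb{R}^d$ is hyperplane absolute winning.
   Context: For $\epsilon>0$, $\mathbf{Bad}_\epsilon(\mathbf{r})=\{(x_1,\ldots,x_d)\in\mathbb{R}^d: \inf_{q\in\mathbb{N}}\max_{1\le i\le d} q^{r_i}\|qx_i\|\ge\epsilon\}$, where $\|\cdot\|$ is the distance to the nearest integer, and $\mathbf{Bad}(\mathbf{r})=\bigcup_{\epsilon>0}\mathbf{Bad}_\epsilon(\mathbf{r})$. Hyperplane absolute game: for $\beta\in(0,1/3)$ and a target set $S\subset\mathbb{R}^d$, two players Alice and Bob alternate. At round $i\ge0$, Bob chooses a closed ball $B_i$ of radius $\rho_i$ with $B_i\subseteq B_{i-1}\setminus\mathcal{H}_{i-1}^{(\delta_{i-1})}$ and $\rho_i\ge\beta\rho_{i-1}$ (arbitrary for $i=0$), then Alice chooses a hyperplane $\mathcal{H}_i$ and $\delta_i\le\beta\rho_i$, where $\mathcal{H}^{(\delta)}=\{\mathbf{x}:\mathrm{dist}(\mathbf{x},\mathcal{H})\le\delta\}$. $S$ is $\beta$-hyperplane absolute winning if Alice has a strategy guaranteeing $\bigcap_i B_i\cap S\neq\emptyset$ regardless of Bob's play; $S$ is hyperplane absolute winning (HAW) if it is $\beta$-HAW for every $\beta\in(0,1/3)$. *)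

theory Defs
  imports "HOL-Analysis.Analysis"
begin

text \<open>Here \<^term>\<open>q\<close> ranges over the positive integers; \<^term>\<open>infdist y \<int>\<close> is the distance from
  \<^term>\<open>y\<close> to the nearest integer.\<close>

definition Bad_eps :: "real \<Rightarrow> real ^ 'n \<Rightarrow> (real ^ 'n) set" where
  "Bad_eps \<epsilon> r =
    {x. (INF q\<in>{1::nat..}. MAX i\<in>UNIV. real q powr (r $ i) * infdist (real q * x $ i) \<int>) \<ge> \<epsilon>}"

definition Bad :: "real ^ 'n \<Rightarrow> (real ^ 'n) set" where
  "Bad r = (\<Union>\<epsilon>\<in>{0<..}. Bad_eps \<epsilon> r)"

definition hyperplane :: "'a::euclidean_space set \<Rightarrow> bool" where
  "hyperplane H \<longleftrightarrow> (\<exists>a b. a \<noteq> 0 \<and> H = {x. a \<bullet> x = b})"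

definition hyperplane_nbhd :: "'a::euclidean_space set \<Rightarrow> real \<Rightarrow> 'a set" where
  "hyperplane_nbhd H \<delta> = {x. infdist x H \<le> \<delta>}"

text \<open>A move of Bob is a pair (centre, radius), standing for a closed ball of positive radius; a move
  of Alice is a pair \<open>(H, \<delta>)\<close>. A strategy of Alice maps the list of the moves made by Bob so far (in
  chronological order, so the current ball is the last element) to her next move.\<close>

type_synonym 'a bob_move = "'a \<times> real"
type_synonym 'a alice_move = "'a set \<times> real"
type_synonym 'a strategy = "'a bob_move list \<Rightarrow> 'a alice_move"

definition ball_of :: "'a::euclidean_space bob_move \<Rightarrow> 'a set" where
  "ball_of p = cball (fst p) (snd p)"

definition legal_strategy :: "real \<Rightarrow> 'a::euclidean_space strategy \<Rightarrow> bool" where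
  "legal_strategy \<beta> \<sigma> \<longleftrightarrow>
    (\<forall>h. h \<noteq> [] \<and> 0 < snd (last h) \<longrightarrow>
      hyperplane (fst (\<sigma> h)) \<and> 0 < snd (\<sigma> h) \<and> snd (\<sigma> h) \<le> \<beta> * snd (last h))"

definition alice_reply :: "'a::euclidean_space strategy \<Rightarrow> (nat \<Rightarrow> 'a bob_move) \<Rightarrow> nat \<Rightarrow> 'a alice_move" where
  "alice_reply \<sigma> B i = \<sigma> (map B [0..<Suc i])"

definition legal_play :: "real \<Rightarrow> 'a::euclidean_space strategy \<Rightarrow> (nat \<Rightarrow> 'a bob_move) \<Rightarrow> bool" where
  "legal_play \<beta> \<sigma> B \<longleftrightarrow>
    (\<forall>i. 0 < snd (B i)) \<and>
    (\<forall>i. snd (B (Suc i)) \<ge> \<beta> * snd (B i) \<and>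
         ball_of (B (Suc i)) \<subseteq>
           ball_of (B i) - hyperplane_nbhd (fst (alice_reply \<sigma> B i)) (snd (alice_reply \<sigma> B i)))"

text \<open>Only infinite plays need to be considered: for \<open>\<beta> < 1/3\<close> Bob always has a legal move.\<close>

definition beta_HAW :: "real \<Rightarrow> 'a::euclidean_space set \<Rightarrow> bool" where
  "beta_HAW \<beta> S \<longleftrightarrow>
    (\<exists>\<sigma>. legal_strategy \<beta> \<sigma> \<and>
      (\<forall>B. legal_play \<beta> \<sigma> B \<longrightarrow> (\<Inter>i. ball_of (B i)) \<inter> S \<noteq> {}))"

definition HAW :: "'a::euclidean_space set \<Rightarrow> bool" where
  "HAW S \<longleftrightarrow> (\<forall>\<beta>\<in>{0<..<1/3}. beta_HAW \<beta> S)"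

end

theory Submission
  imports Defs
begin

text \<open>By pigeonhole every rational point \<open>p / q\<close> lies on a rational hyperplane \<open>a \<bullet> x + b = 0\<close> with
  \<open>\<bar>a i\<bar> \<le> q powr r i\<close>, and the box of points that \<open>p / q\<close> approximates too well lies within about
  \<open>1 / H\<close> of this hyperplane, where \<open>H = q * max \<bar>a i\<bar>\<close> is the height. So the box can be deleted when
  Bob's radius is about \<open>1 / H\<close>, provided that one hyperplane suffices at a time. The points are split
  into classes according to the flatness \<open>D = q / H powr (1 / (1 + R))\<close>, with \<open>R\<close> the maximal
  weight. In each class one hyperplane suffices, for the following reasons. If \<open>D\<close> is at most a fixed
  power of the inverse of the size of the boxes, all the points lie on the hyperplane of the point of
  smallest denominator, because an integer of modulus less than \<open>1\<close> vanishes. If \<open>D\<close> is larger, two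
  distinct hyperplanes would have a small integer combination, since all coefficients but one are
  smaller by a factor \<open>D\<close> than the weights allow. By transference this would give a rational point of
  smaller height whose box contains the centre of Bob's ball, although that box has been deleted before.
  Flatter classes have geometrically larger windows of radii in which they may be treated, so each
  class gets its turn in time.\<close>

section \<open>Pigeonhole arguments\<close>

text \<open>As the weights sum to 1, more than \<open>q\<close> integer vectors have entries between
  0 and \<open>q powr r i\<close>, so two of them give the same sum modulo \<open>q\<close>. Their
  difference is the covector.\<close>

lemma exists_covector:
  fixes r :: "real ^ 'n" and p :: "'n \<Rightarrow> int"
  assumes sum: "(\<Sum>i\<in>UNIV. r $ i) = 1" and q: "1 \<le> q"
  obtains a :: "'n \<Rightarrow> int" and b :: int
  where "\<exists>i. a i \<noteq> 0" "\<And>i. \<bar>real_of_int (a i)\<bar> \<le> real q powr (r $ i)"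
    "(\<Sum>i\<in>UNIV. a i * p i) + b * int q = 0"
proof -
  define S where "S = (\<Pi>\<^sub>E i\<in>(UNIV::'n set). {0..\<lfloor>real q powr (r $ i)\<rfloor>})"
  define f where "f a = (\<Sum>i\<in>UNIV. a i * p i) mod int q" for a :: "'n \<Rightarrow> int"
  have fin: "finite S"
    unfolding S_def by (intro finite_PiE) auto
  have "real q = (\<Prod>i\<in>(UNIV::'n set). real q powr (r $ i))"
    using q sum by (subst powr_sum[symmetric]) auto
  also have "\<dots> < (\<Prod>i\<in>(UNIV::'n set). real_of_int (\<lfloor>real q powr (r $ i)\<rfloor> + 1))"
  \<comment> \<open>\<open>undefined\<close> stands for some index: strictness is asked for at one
    factor, and it holds at all of them.\<close>
  proof (rule prod_mono_strict[of undefined])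
    fix i
    show "0 \<le> real q powr (r $ i) \<and> real q powr (r $ i) \<le> real_of_int (\<lfloor>real q powr (r $ i)\<rfloor> + 1)"
      by simp
    show "0 < real_of_int (\<lfloor>real q powr (r $ i)\<rfloor> + 1)"
      using zero_le_floor[of "real q powr (r $ i)"] powr_ge_zero[of "real q" "r $ i"] by linarith
    show "real q powr (r $ undefined) < real_of_int (\<lfloor>real q powr (r $ undefined)\<rfloor> + 1)"
      by linarith
  qed simp_all
  also have "\<dots> = real (card S)"
    unfolding S_def by (subst card_PiE) (auto intro!: prod.cong)
  finally have "q < card S" by simp
  moreover have "f ` S \<subseteq> {0..<int q}"
    using q unfolding f_def by auto
  then have "card (f ` S) \<le> card {0..<int q}"
    by (rule card_mono[rotated]) auto
  ultimately have "\<not> inj_on f S"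
    using pigeonhole[of f S] by auto
  then obtain a a' where aa: "a \<in> S" "a' \<in> S" "a \<noteq> a'" "f a = f a'"
    unfolding inj_on_def by blast
  have "int q dvd (\<Sum>i\<in>UNIV. a i * p i) - (\<Sum>i\<in>UNIV. a' i * p i)"
    using aa(4) unfolding f_def by (simp add: mod_eq_dvd_iff)
  then obtain m where m: "(\<Sum>i\<in>UNIV. a i * p i) - (\<Sum>i\<in>UNIV. a' i * p i) = int q * m" ..
  show thesis
  proof (rule that[of "\<lambda>i. a i - a' i" "- m"])
    show "\<exists>i. a i - a' i \<noteq> 0" using aa(3) by auto
    show "(\<Sum>i\<in>UNIV. (a i - a' i) * p i) + - m * int q = 0"
      using m by (simp add: algebra_simps sum_subtractf)
    fix i
    have "a i \<in> {0..\<lfloor>real q powr (r $ i)\<rfloor>}" "a' i \<in> {0..\<lfloor>real q powr (r $ i)\<rfloor>}"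
      using aa(1,2) unfolding S_def by auto
    then have "\<bar>a i - a' i\<bar> \<le> \<lfloor>real q powr (r $ i)\<rfloor>" by auto
    then show "\<bar>real_of_int (a i - a' i)\<bar> \<le> real q powr (r $ i)"
      by linarith
  qed
qed

text \<open>Pigeonhole over the multiples of \<open>x\<close>. Let \<open>j\<close> maximise
  \<open>\<bar>w i\<bar> * T powr - (r i)\<close>. The multiples are sorted by the fractional parts
  of the coordinates other than \<open>j\<close> and by the residue of an integer modulo
  \<open>\<bar>w j\<bar>\<close>. That residue allows a \<open>p j\<close> to be chosen with
  \<open>w \<bullet> p + b * q = 0\<close>, and then the smallness of the form at \<open>x\<close>
  bounds the error in coordinate \<open>j\<close>.\<close>

lemma transference:
  fixes r x :: "real ^ 'n" and w :: "'n \<Rightarrow> int" and T \<eta> \<theta> :: real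
  assumes sum: "(\<Sum>i\<in>UNIV. r $ i) = 1" and r0: "\<And>i. r $ i \<ge> 0"
    and T: "1 \<le> T" and \<eta>: "0 < \<eta>" and \<theta>: "0 < \<theta>" "\<theta> < 1"
    and \<theta>\<eta>: "2 ^ CARD('n) * \<eta> \<le> \<theta> ^ CARD('n)"
    and w0: "(\<exists>i. w i \<noteq> 0) \<or> b \<noteq> 0"
    and wi: "\<And>i. \<bar>real_of_int (w i)\<bar> \<le> \<eta> * T powr (r $ i)"
    and wx: "\<bar>(\<Sum>i\<in>UNIV. real_of_int (w i) * x $ i) + real_of_int b\<bar> \<le> \<eta> / T"
  obtains q :: nat and p :: "'n \<Rightarrow> int"
  where "1 \<le> q" "real q \<le> \<theta> * T"
    "\<And>i. \<bar>real q * x $ i - real_of_int (p i)\<bar> \<le> CARD('n) * \<theta> * T powr - (r $ i)"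
proof -
  have "2 ^ CARD('n) * \<eta> < 1"
    using \<theta>\<eta> \<theta> power_less_one_iff[of \<theta> "CARD('n)"] by (simp add: order_le_less_trans)
  moreover have "1 * \<eta> \<le> 2 ^ CARD('n) * \<eta>" using \<eta> by (intro mult_right_mono) auto
  ultimately have \<eta>1: "\<eta> < 1" by linarith
  \<comment> \<open>Otherwise the nonzero integer \<open>b\<close> alone would have modulus less
    than 1.\<close>
  have "\<exists>i. w i \<noteq> 0"
  proof (rule ccontr)
    assume "\<not> ?thesis"
    then have "w i = 0" for i by auto
    then have "\<bar>real_of_int b\<bar> \<le> \<eta> / T" using wx by simp
    also have "\<dots> < 1" using T \<eta>1 by (simp add: divide_less_eq)
    finally show False using w0 \<open>\<And>i. w i = 0\<close> by auto
  qed
  then obtain i0 where i0: "w i0 \<noteq> 0" ..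
  define g where "g i = \<bar>real_of_int (w i)\<bar> * T powr - (r $ i)" for i
  have "Max (range g) \<in> range g" by (intro Max_in) auto
  then obtain j where j: "g j = Max (range g)" by (metis rangeE)
  have gj: "g i \<le> g j" for i unfolding j by (intro Max_ge) auto
  have "0 < g i0" using i0 T unfolding g_def by auto
  then have gj0: "0 < g j" using gj[of i0] by linarith
  have Tp: "T powr a > 0" for a using T by auto
  have wj: "w j \<noteq> 0" using gj0 unfolding g_def by auto
  have wg: "\<bar>real_of_int (w i)\<bar> = g i * T powr (r $ i)" for i
    using T unfolding g_def by (simp add: powr_minus)
  have gj\<eta>: "g j \<le> \<eta>"
    using wi[of j] Tp[of "r $ j"] unfolding wg[of j] by simp
  define v where "v = \<bar>w j\<bar>"
  have v: "1 \<le> v" using wj unfolding v_def by auto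
  have vr: "real_of_int v = g j * T powr (r $ j)"
    unfolding v_def using wg[of j] by simp
  \<comment> \<open>Chosen so that \<open>Q * (\<eta> / T) = \<theta> * g j\<close>: the form then
    adds to the error in coordinate \<open>j\<close> no more than any other coordinate does.\<close>
  define Q where "Q = \<theta> * T * g j / \<eta>"
  have Q0: "0 < Q" using \<theta> T gj0 \<eta> unfolding Q_def by auto
  have QT: "Q \<le> \<theta> * T"
    using gj\<eta> \<eta> \<theta> T unfolding Q_def by (simp add: divide_le_eq mult_left_mono)
  define \<delta> where "\<delta> i = \<theta> * T powr - (r $ i)" for i
  have \<delta>0: "0 < \<delta> i" for i using \<theta> T unfolding \<delta>_def by auto
  have \<delta>1: "\<delta> i \<le> 1" for i
  proof -
    have "T powr - (r $ i) \<le> 1"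
      using T r0[of i] by (simp add: powr_minus inverse_le_1_iff ge_one_powr_ge_zero)
    then show ?thesis using \<theta> Tp[of "- (r $ i)"] unfolding \<delta>_def by (intro mult_le_one) auto
  qed
  define U where "U = UNIV - {j}"
  have Uj: "UNIV = insert j U" "j \<notin> U" "finite U" unfolding U_def by auto
  define h where "h q = (\<Sum>i\<in>U. w i * \<lfloor>real q * x $ i\<rfloor>) + b * int q" for q
  define f where "f q = (\<lambda>i. if i = j then h q mod v else \<lfloor>frac (real q * x $ i) / \<delta> i\<rfloor>)" for q
  define C where "C i = (if i = j then {0..<v} else {0..\<lfloor>1 / \<delta> i\<rfloor>})" for i
  define S where "S = (\<Pi>\<^sub>E i\<in>(UNIV::'n set). C i)"
  have fin: "finite S"
    unfolding S_def C_def by (intro finite_PiE) auto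
  have fS: "f q \<in> S" for q
  proof -
    have "frac (real q * x $ i) / \<delta> i \<le> 1 / \<delta> i" for i
      using \<delta>0[of i] frac_lt_1[of "real q * x $ i"] by (intro divide_right_mono) auto
    then show ?thesis
      unfolding S_def C_def f_def using v \<delta>0
      by (auto intro!: floor_mono simp: less_imp_le)
  qed
  have "real (card S) = real_of_int v * (\<Prod>i\<in>U. real (card (C i)))"
    proof -
    have "(\<Prod>i\<in>UNIV. real (card (C i))) = real (card (C j)) * (\<Prod>i\<in>U. real (card (C i)))"
      unfolding Uj(1) using Uj(2,3) by simp
    then show ?thesis unfolding S_def using v by (subst card_PiE) (auto simp: C_def)
  qed
  also have "(\<Prod>i\<in>U. real (card (C i))) \<le> (\<Prod>i\<in>U. 2 / \<delta> i)"
  proof (intro prod_mono conjI)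
    fix i assume "i \<in> U"
    then have "real (card (C i)) = real_of_int (\<lfloor>1 / \<delta> i\<rfloor> + 1)"
      using \<delta>0[of i] unfolding C_def U_def by auto
    also have "\<dots> \<le> 1 / \<delta> i + 1" by simp
    also have "\<dots> \<le> 2 / \<delta> i" using \<delta>0[of i] \<delta>1[of i] by (simp add: field_simps)
    finally show "real (card (C i)) \<le> 2 / \<delta> i" .
  qed auto
  also have "(\<Prod>i\<in>U. 2 / \<delta> i) = (\<Prod>i\<in>U. (2 / \<theta>) * T powr (r $ i))"
    unfolding \<delta>_def by (simp add: powr_minus field_simps)
  also have "\<dots> = (2 / \<theta>) ^ (CARD('n) - 1) * T powr (\<Sum>i\<in>U. r $ i)"
    unfolding prod.distrib using T by (simp add: powr_sum U_def)
  also have "(\<Sum>i\<in>U. r $ i) = 1 - r $ j"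
    using sum Uj sum.insert[of U j "\<lambda>i. r $ i"] by simp
  finally have "real (card S) \<le> real_of_int v * ((2 / \<theta>) ^ (CARD('n) - 1) * T powr (1 - r $ j))"
    using v by (simp add: mult_left_mono)
  also have "\<dots> = g j * T * (2 / \<theta>) ^ (CARD('n) - 1)"
    unfolding vr using T by (simp add: powr_diff)
  \<comment> \<open>This comparison is what the hypothesis relating \<open>\<theta>\<close> and
    \<open>\<eta>\<close> is made for.\<close>
  also have "\<dots> \<le> Q"
  proof -
    have 1: "(2::real) ^ CARD('n) = 2 * 2 ^ (CARD('n) - 1)" "\<theta> ^ CARD('n) = \<theta> * \<theta> ^ (CARD('n) - 1)"
      by (metis One_nat_def Suc_pred power_Suc zero_less_card_finite)+
    have "2 ^ (CARD('n) - 1) * \<eta> \<le> \<theta> * \<theta> ^ (CARD('n) - 1)"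
    proof -
      have "0 < 2 ^ (CARD('n) - 1) * \<eta>" using \<eta> by simp
      then show ?thesis using \<theta>\<eta> unfolding 1 by linarith
    qed
    then have "(2 / \<theta>) ^ (CARD('n) - 1) \<le> \<theta> / \<eta>"
      using \<theta> \<eta> by (simp add: power_divide divide_simps mult.commute)
    then have "g j * T * (2 / \<theta>) ^ (CARD('n) - 1) \<le> g j * T * (\<theta> / \<eta>)"
      using gj0 T by (intro mult_left_mono) auto
    then show ?thesis unfolding Q_def by (simp add: mult_ac)
  qed
  finally have cS: "real (card S) \<le> Q" .
  \<comment> \<open>The range starts at 0, hence has \<open>nat \<lfloor>Q\<rfloor> + 1\<close>
    elements, which is more than \<open>Q\<close>.\<close>
  have "card S < card {0..nat \<lfloor>Q\<rfloor>}"
    using cS Q0 by simp linarith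
  moreover have "card (f ` {0..nat \<lfloor>Q\<rfloor>}) \<le> card S"
    using fS fin by (intro card_mono) auto
  ultimately have "\<not> inj_on f {0..nat \<lfloor>Q\<rfloor>}"
    by (intro pigeonhole) linarith
  then obtain q1 q2 where qq: "f q1 = f q2" "q1 < q2" "q2 \<le> nat \<lfloor>Q\<rfloor>"
    unfolding inj_on_def by (metis atLeastAtMost_iff linorder_neqE_nat)
  define q where "q = q2 - q1"
  have q1: "1 \<le> q" and rq: "real q = real q2 - real q1" and iq: "int q = int q2 - int q1"
    using qq unfolding q_def by auto
  have qQ: "real q \<le> Q" using qq(3) Q0 rq by linarith
  have "h q2 mod v = h q1 mod v"
    using fun_cong[OF qq(1), of j] unfolding f_def by simp
  then have "w j dvd h q2 - h q1"
    by (simp add: mod_eq_dvd_iff v_def)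
  then obtain m where m: "h q2 - h q1 = w j * m" ..
  \<comment> \<open>The entry \<open>- m\<close> cancels \<open>h q2 - h q1 = w j * m\<close>, so
    that \<open>p / q\<close> lies on the hyperplane of \<open>w\<close> and
    \<open>b\<close>.\<close>
  define p where "p i = (if i = j then - m else \<lfloor>real q2 * x $ i\<rfloor> - \<lfloor>real q1 * x $ i\<rfloor>)" for i
  have pU: "\<bar>real q * x $ i - real_of_int (p i)\<bar> \<le> \<delta> i" if "i \<noteq> j" for i
  proof -
    let ?u = "frac (real q1 * x $ i) / \<delta> i" and ?v = "frac (real q2 * x $ i) / \<delta> i"
    have "\<lfloor>?u\<rfloor> = \<lfloor>?v\<rfloor>"
      using fun_cong[OF qq(1), of i] that unfolding f_def by simp
    then have "\<bar>?v - ?u\<bar> \<le> 1" by linarith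
    moreover have "real q * x $ i - real_of_int (p i) = (?v - ?u) * \<delta> i"
      using that \<delta>0[of i] unfolding p_def rq frac_def by (simp add: field_simps)
    ultimately show ?thesis
      using \<delta>0[of i] by (simp add: abs_mult mult_left_le_one_le)
  qed
  have "(\<Sum>i\<in>U. w i * p i) + b * int q = h q2 - h q1"
  proof -
    have "(\<Sum>i\<in>U. w i * p i) = (\<Sum>i\<in>U. w i * \<lfloor>real q2 * x $ i\<rfloor> - w i * \<lfloor>real q1 * x $ i\<rfloor>)"
      unfolding p_def U_def by (intro sum.cong) (auto simp: right_diff_distrib)
    then show ?thesis unfolding h_def iq by (simp add: sum_subtractf right_diff_distrib)
  qed
  then have "(\<Sum>i\<in>UNIV. w i * p i) + b * int q = 0"
    using Uj m sum.insert[of U j "\<lambda>i. w i * p i"] by (simp add: p_def)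
  then have "real_of_int ((\<Sum>i\<in>UNIV. w i * p i) + b * int q) = 0" by simp
  then have wp: "(\<Sum>i\<in>UNIV. real_of_int (w i) * real_of_int (p i)) + real_of_int b * real q = 0" by simp
  have "(\<Sum>i\<in>UNIV. real_of_int (w i) * (real q * x $ i - real_of_int (p i)))
      = real q * ((\<Sum>i\<in>UNIV. real_of_int (w i) * x $ i) + real_of_int b)"
    using wp by (simp add: algebra_simps sum_subtractf sum_distrib_left)
  then have "real_of_int (w j) * (real q * x $ j - real_of_int (p j))
      = real q * ((\<Sum>i\<in>UNIV. real_of_int (w i) * x $ i) + real_of_int b)
        - (\<Sum>i\<in>U. real_of_int (w i) * (real q * x $ i - real_of_int (p i)))"
    using Uj sum.insert[of U j "\<lambda>i. real_of_int (w i) * (real q * x $ i - real_of_int (p i))"] by simp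
  then have "\<bar>real_of_int (w j)\<bar> * \<bar>real q * x $ j - real_of_int (p j)\<bar>
      \<le> \<bar>real q * ((\<Sum>i\<in>UNIV. real_of_int (w i) * x $ i) + real_of_int b)\<bar>
        + \<bar>\<Sum>i\<in>U. real_of_int (w i) * (real q * x $ i - real_of_int (p i))\<bar>"
    unfolding abs_mult[symmetric] by linarith
  also have "\<bar>real q * ((\<Sum>i\<in>UNIV. real_of_int (w i) * x $ i) + real_of_int b)\<bar> \<le> Q * (\<eta> / T)"
    unfolding abs_mult using qQ wx by (intro mult_mono) auto
  also have "Q * (\<eta> / T) = \<theta> * g j"
    using \<eta> T unfolding Q_def by (simp add: field_simps)
  also have "\<bar>\<Sum>i\<in>U. real_of_int (w i) * (real q * x $ i - real_of_int (p i))\<bar>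
      \<le> (\<Sum>i\<in>U. \<theta> * g j)"
  proof (rule order_trans[OF sum_abs sum_mono])
    fix i assume "i \<in> U"
    then have "i \<noteq> j" unfolding U_def by auto
    have "\<bar>real_of_int (w i) * (real q * x $ i - real_of_int (p i))\<bar> \<le> \<bar>real_of_int (w i)\<bar> * \<delta> i"
      unfolding abs_mult using pU[OF \<open>i \<noteq> j\<close>] by (intro mult_left_mono) auto
    also have "\<dots> = g i * \<theta>"
      unfolding wg \<delta>_def using T by (simp add: powr_minus)
    also have "\<dots> \<le> g j * \<theta>" using gj[of i] \<theta> by (intro mult_right_mono) auto
    finally show "\<bar>real_of_int (w i) * (real q * x $ i - real_of_int (p i))\<bar> \<le> \<theta> * g j"
      by (simp add: mult.commute)
  qed
  also have "\<theta> * g j + (\<Sum>i\<in>U. \<theta> * g j) = CARD('n) * \<theta> * g j"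
    unfolding U_def by (simp add: of_nat_diff algebra_simps)
  finally have "g j * (T powr (r $ j) * \<bar>real q * x $ j - real_of_int (p j)\<bar>) \<le> g j * (CARD('n) * \<theta>)"
    unfolding wg by (simp add: mult_ac)
  then have "T powr (r $ j) * \<bar>real q * x $ j - real_of_int (p j)\<bar> \<le> CARD('n) * \<theta>"
    using gj0 by simp
  then have pj: "\<bar>real q * x $ j - real_of_int (p j)\<bar> \<le> CARD('n) * \<theta> * T powr - (r $ j)"
    using Tp[of "r $ j"] by (simp add: powr_minus field_simps)
  show thesis
  proof (rule that[OF q1, of p])
    show "real q \<le> \<theta> * T" using qQ QT by linarith
    fix i
    show "\<bar>real q * x $ i - real_of_int (p i)\<bar> \<le> CARD('n) * \<theta> * T powr - (r $ i)"
    proof (cases "i = j")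
      case True
      then show ?thesis using pj by simp
    next
      case False
      have "(1::real) \<le> CARD('n)" by simp
      then have "\<delta> i \<le> CARD('n) * \<delta> i" using \<delta>0[of i] by (simp add: mult_le_cancel_right1)
      then show ?thesis using pU[OF False] unfolding \<delta>_def by (simp add: mult_ac)
    qed
  qed
qed

section \<open>Scheduling of the classes\<close>

text \<open>The 2-adic valuation, with value 0 at 0.\<close>

fun ruler :: "nat \<Rightarrow> nat" where
  "ruler n = (if odd n \<or> n = 0 then 0 else Suc (ruler (n div 2)))"

declare ruler.simps [simp del]

text \<open>Positive numbers of valuation exactly \<open>v\<close> are spaced
  \<open>2 ^ Suc v\<close> apart. Doubling carries a window for \<open>v\<close> to one for
  \<open>Suc v\<close>.\<close>

lemma ruler_window: "\<exists>j>i. j \<le> i + 2 ^ Suc v \<and> ruler j = v"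
proof (induction v arbitrary: i)
  case 0
  show ?case
  proof (cases "even i")
    case True
    then show ?thesis by (intro exI[of _ "i + 1"]) (auto simp: ruler.simps)
  next
    case False
    then show ?thesis by (intro exI[of _ "i + 2"]) (auto simp: ruler.simps)
  qed
next
  case (Suc v)
  obtain j where j: "j > i div 2" "j \<le> i div 2 + 2 ^ Suc v" "ruler j = v"
    using Suc.IH by blast
  have "ruler (2 * j) = Suc v" using j by (subst ruler.simps) auto
  then show ?case using j by (intro exI[of _ "2 * j"]) auto
qed

text \<open>Class \<open>N * v + e\<close> with \<open>e < N\<close> is served at the times
  \<open>N * j + e\<close> with \<open>ruler j = v\<close>. The gaps double only once in
  \<open>N\<close> classes, and \<open>2 \<le> (1 + 1 / N) ^ N\<close> by Bernoulli, so the waiting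
  time grows by a factor of about \<open>1 + 1 / N\<close> per class.\<close>

lemma class_schedule:
  assumes N: "1 \<le> N"
  obtains cls :: "nat \<Rightarrow> nat"
  where "\<And>\<kappa> i. \<exists>j>i. real j \<le> real i + 4 * real N * (1 + 1 / real N) ^ \<kappa> \<and> cls j = \<kappa>"
proof
  fix \<kappa> i :: nat
  define v e where "v = \<kappa> div N" and "e = \<kappa> mod N"
  obtain j where j: "j > i div N" "j \<le> i div N + 2 ^ Suc v" "ruler j = v"
    using ruler_window by blast
  have e: "e < N" and \<kappa>: "N * v + e = \<kappa>" using N unfolding v_def e_def by auto
  have "i < N * j + e"
  proof -
    have "i < N * (i div N) + N" using N by (metis add_less_cancel_left mod_less_divisor mult_div_mod_eq zero_less_one less_le_trans)
    also have "\<dots> = N * Suc (i div N)" by simp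
    also have "\<dots> \<le> N * j" using j(1) by (intro mult_le_mono2) simp
    finally show ?thesis by simp
  qed
  moreover have "real (N * j + e) \<le> real i + 4 * real N * (1 + 1 / real N) ^ \<kappa>"
  proof -
    have "N * j + e \<le> N * (i div N + 2 ^ Suc v) + N"
      using j(2) e by (intro add_mono mult_le_mono2) auto
    also have "\<dots> \<le> i + N * 2 ^ Suc v + N"
      by (simp add: add_mult_distrib2)
    finally have "real (N * j + e) \<le> real (i + N * 2 ^ Suc v + N)"
      by (rule of_nat_mono)
    also have "\<dots> = real i + 2 * real N * 2 ^ v + real N * 1" by simp
    also have "\<dots> \<le> real i + 2 * real N * 2 ^ v + real N * (2 * 2 ^ v)"
      by (intro add_left_mono mult_left_mono) (auto intro: order_trans[OF one_le_power[of 2 v]])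
    also have "\<dots> = real i + 4 * real N * 2 ^ v" by simp
    finally have 1: "real (N * j + e) \<le> real i + 4 * real N * 2 ^ v" .
    have "(2::real) ^ v \<le> ((1 + 1 / real N) ^ N) ^ v"
    proof (intro power_mono)
      show "2 \<le> (1 + 1 / real N) ^ N"
        using Bernoulli_inequality[of "1 / real N" N] N order_trans[of "-1" 0 "1 / real N"] by simp
    qed auto
    also have "\<dots> = (1 + 1 / real N) ^ (N * v)" by (simp add: power_mult)
    also have "\<dots> \<le> (1 + 1 / real N) ^ \<kappa>"
      using \<kappa> by (intro power_increasing) auto
    finally have "4 * real N * 2 ^ v \<le> 4 * real N * (1 + 1 / real N) ^ \<kappa>"
      by (intro mult_left_mono) auto
    then show ?thesis using 1 by linarith
  qed
  moreover have "N * ruler ((N * j + e) div N) + (N * j + e) mod N = \<kappa>"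
    using e j(3) \<kappa> by simp
  ultimately show "\<exists>j>i. real j \<le> real i + 4 * real N * (1 + 1 / real N) ^ \<kappa> \<and>
      (\<lambda>j. N * ruler (j div N) + j mod N) j = \<kappa>"
    by blast
qed

section \<open>Rational hyperplanes and boxes\<close>

text \<open>Dirichlet's theorem for the quotient of the two integers, the larger modulus being taken
  as the denominator.\<close>

lemma small_integer_combination:
  fixes \<alpha> \<beta> :: int and S :: real
  assumes "\<bar>real_of_int \<alpha>\<bar> \<le> S" "\<bar>real_of_int \<beta>\<bar> \<le> S" "0 < N"
  obtains k h :: int
  where "(k, h) \<noteq> (0, 0)" "\<bar>k\<bar> \<le> int N" "\<bar>h\<bar> \<le> int N"
    "\<bar>real_of_int (k * \<alpha> + h * \<beta>)\<bar> \<le> S / real N"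
proof -
  have main: "\<exists>k h. (k, h) \<noteq> (0, 0) \<and> \<bar>k\<bar> \<le> int N \<and> \<bar>h\<bar> \<le> int N \<and>
      \<bar>real_of_int (k * \<alpha> + h * \<beta>)\<bar> \<le> S / real N"
    if le: "\<bar>\<alpha>\<bar> \<le> \<bar>\<beta>\<bar>" and S: "\<bar>real_of_int \<beta>\<bar> \<le> S" for \<alpha> \<beta> :: int
  proof (cases "\<beta> = 0")
    case True
    then have "\<alpha> = 0" using le by simp
    then show ?thesis using True S \<open>0 < N\<close> by (intro exI[of _ 1] exI[of _ 0]) auto
  next
    case False
    define t where "t = real_of_int \<alpha> / real_of_int \<beta>"
    have t: "\<bar>t\<bar> \<le> 1"
      using le False unfolding t_def abs_divide by (simp add: divide_le_eq_1 flip: of_int_abs)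
    obtain h k where hk: "0 < k" "k \<le> int N" "\<bar>real_of_int k * t - real_of_int h\<bar> < 1 / real N"
      using Dirichlet_approx[of N t] \<open>0 < N\<close> by blast
    have N1: "1 / real N \<le> 1" using \<open>0 < N\<close> by simp
    have "\<bar>real_of_int k * t\<bar> \<le> real_of_int k * 1"
      unfolding abs_mult using hk(1) t by (intro mult_mono) auto
    then have "\<bar>real_of_int h\<bar> < real_of_int (int N) + 1"
      using hk N1 by linarith
    then have h: "\<bar>h\<bar> \<le> int N" by linarith
    have "\<bar>real_of_int (k * \<alpha> + - h * \<beta>)\<bar> = \<bar>real_of_int \<beta>\<bar> * \<bar>real_of_int k * t - real_of_int h\<bar>"
    proof -
      have "real_of_int (k * \<alpha> + - h * \<beta>) = real_of_int \<beta> * (real_of_int k * t - real_of_int h)"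
        using False unfolding t_def by (simp add: field_simps)
      then show ?thesis by (simp only: abs_mult)
    qed
    also have "\<dots> \<le> S * (1 / real N)"
      using hk(3) S by (intro mult_mono) auto
    finally show ?thesis
      using hk h by (intro exI[of _ k] exI[of _ "- h"]) auto
  qed
  show thesis
  proof (cases "\<bar>\<alpha>\<bar> \<le> \<bar>\<beta>\<bar>")
    case True
    then show ?thesis using main[OF True assms(2)] that by blast
  next
    case False
    then obtain k h where "(k, h) \<noteq> (0, 0)" "\<bar>k\<bar> \<le> int N" "\<bar>h\<bar> \<le> int N"
      "\<bar>real_of_int (k * \<beta> + h * \<alpha>)\<bar> \<le> S / real N"
      using main[of \<beta> \<alpha>] assms(1) by (metis linorder_not_le order_less_imp_le)
    then show ?thesis using that[of h k] by (auto simp: add.commute)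
  qed
qed

section \<open>Affine forms with integer coefficients and their zero sets\<close>

definition affine_form :: "('n \<Rightarrow> int) \<Rightarrow> int \<Rightarrow> real ^ 'n \<Rightarrow> real" where
  "affine_form a b x = (\<Sum>i\<in>UNIV. real_of_int (a i) * x $ i) + real_of_int b"

definition rational_hyperplane :: "('n \<Rightarrow> int) \<Rightarrow> int \<Rightarrow> (real ^ 'n) set" where
  "rational_hyperplane a b = {x. affine_form a b x = 0}"

definition max_coeff :: "('n::finite \<Rightarrow> int) \<Rightarrow> real" where
  "max_coeff a = real_of_int (MAX i. \<bar>a i\<bar>)"

lemma max_coeff_ge: "\<bar>real_of_int (a i)\<bar> \<le> max_coeff a"
proof -
  have "\<bar>a i\<bar> \<le> (MAX i. \<bar>a i\<bar>)" by (intro Max_ge) auto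
  then show ?thesis unfolding max_coeff_def by linarith
qed

lemma max_coeff_attained:
  obtains i where "max_coeff a = \<bar>real_of_int (a i)\<bar>"
proof -
  have "(MAX i. \<bar>a i\<bar>) \<in> range (\<lambda>i. \<bar>a i\<bar>)" by (intro Max_in) auto
  then obtain i where "(MAX i. \<bar>a i\<bar>) = \<bar>a i\<bar>" by (rule imageE)
  then show thesis using that[of i] unfolding max_coeff_def by simp
qed

lemma max_coeff_ge_1:
  fixes a :: "'n::finite \<Rightarrow> int"
  assumes "\<exists>i. a i \<noteq> 0"
  shows "1 \<le> max_coeff a"
proof -
  obtain i where "a i \<noteq> 0" using assms ..
  then have "1 \<le> \<bar>real_of_int (a i)\<bar>" by linarith
  then show ?thesis using max_coeff_ge[of a i] by linarith
qed

lemma max_coeff_le_norm: "max_coeff a \<le> norm ((\<chi> i. real_of_int (a i)) :: real ^ 'n)"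
proof -
  obtain i where "max_coeff a = \<bar>real_of_int (a i)\<bar>" by (rule max_coeff_attained)
  also have "\<dots> \<le> norm ((\<chi> i. real_of_int (a i)) :: real ^ 'n)"
    using component_le_norm_cart[of "\<chi> i. real_of_int (a i)" i] by simp
  finally show ?thesis .
qed

lemma affine_form_inner:
  "affine_form a b x = (\<chi> i. real_of_int (a i)) \<bullet> x + real_of_int b"
  unfolding affine_form_def inner_vec_def by simp

lemma affine_form_combination:
  "affine_form (\<lambda>i. k * a i + h * a' i) (k * b + h * b') x
    = real_of_int k * affine_form a b x + real_of_int h * affine_form a' b' x"
  unfolding affine_form_def by (simp add: algebra_simps sum.distrib sum_distrib_left)

lemma affine_form_diff_le:
  fixes x y :: "real ^ 'n"
  shows "\<bar>affine_form a b x - affine_form a b y\<bar> \<le> CARD('n) * max_coeff a * dist x y"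
proof -
  have "affine_form a b x - affine_form a b y = (\<Sum>i\<in>UNIV. real_of_int (a i) * (x - y) $ i)"
    unfolding affine_form_def by (simp add: algebra_simps sum_subtractf)
  also have "\<bar>\<dots>\<bar> \<le> (\<Sum>i\<in>(UNIV::'n set). max_coeff a * dist x y)"
  proof (rule order_trans[OF sum_abs sum_mono])
    fix i
    show "\<bar>real_of_int (a i) * (x - y) $ i\<bar> \<le> max_coeff a * dist x y"
      unfolding abs_mult dist_norm using max_coeff_ge[of a i] component_le_norm_cart[of "x - y" i]
      by (intro mult_mono) auto
  qed
  finally show ?thesis by simp
qed

lemma hyperplane_rational_hyperplane:
  fixes a :: "'n::finite \<Rightarrow> int"
  assumes "\<exists>i. a i \<noteq> 0"
  shows "hyperplane (rational_hyperplane a b)"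
proof -
  have "(\<chi> i. real_of_int (a i)) \<noteq> 0"
    using assms by (auto simp: vec_eq_iff)
  moreover have "rational_hyperplane a b = {x. (\<chi> i. real_of_int (a i)) \<bullet> x = - real_of_int b}"
    unfolding rational_hyperplane_def affine_form_inner by auto
  ultimately show ?thesis unfolding hyperplane_def by blast
qed

text \<open>The foot of the perpendicular is at distance
  \<open>\<bar>affine_form a b x\<bar> / norm v\<close>, and the Euclidean norm is at least the
  largest coefficient.\<close>

lemma infdist_rational_hyperplane_le:
  fixes a :: "'n::finite \<Rightarrow> int"
  assumes "\<exists>i. a i \<noteq> 0"
  shows "infdist x (rational_hyperplane a b) \<le> \<bar>affine_form a b x\<bar> / max_coeff a"
proof -
  define v where "v = (\<chi> i. real_of_int (a i))"
  have "v \<noteq> 0" using assms unfolding v_def by (auto simp: vec_eq_iff)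
  then have nv: "0 < norm v" by simp
  define y where "y = x - (affine_form a b x / (v \<bullet> v)) *\<^sub>R v"
  have "affine_form a b y = 0"
    using \<open>v \<noteq> 0\<close> unfolding affine_form_inner y_def v_def[symmetric] by (simp add: inner_diff_right)
  then have "infdist x (rational_hyperplane a b) \<le> dist x y"
    unfolding rational_hyperplane_def by (intro infdist_le) simp
  also have "\<dots> = \<bar>affine_form a b x\<bar> / norm v"
    using nv unfolding y_def dist_norm by (simp add: power2_norm_eq_inner[symmetric] power2_eq_square)
  also have "\<dots> \<le> \<bar>affine_form a b x\<bar> / max_coeff a"
    using max_coeff_le_norm[of a] max_coeff_ge_1[OF assms] nv unfolding v_def
    by (intro divide_left_mono) auto
  finally show ?thesis .
qed

section \<open>Boxes of points too close to a rational point\<close>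

definition bad_box :: "real ^ 'n \<Rightarrow> real \<Rightarrow> nat \<Rightarrow> ('n \<Rightarrow> int) \<Rightarrow> (real ^ 'n) set" where
  "bad_box r c q p = {x. \<forall>i. \<bar>real q * x $ i - real_of_int (p i)\<bar> < c * real q powr - (r $ i)}"

text \<open>For each \<open>q\<close> the box whose numerators are the integers nearest to
  \<open>q * x\<close> decides the matter: leaving it in one coordinate bounds the maximum from
  below.\<close>

lemma Bad_eps_if_avoids_boxes:
  assumes "\<And>q p. 1 \<le> q \<Longrightarrow> x \<notin> bad_box r c q p"
  shows "x \<in> Bad_eps c r"
  unfolding Bad_eps_def mem_Collect_eq
proof (rule cINF_greatest)
  fix q :: nat
  assume "q \<in> {1..}"
  then have q: "1 \<le> q" by simp
  obtain i where i: "\<bar>real q * x $ i - real_of_int (round (real q * x $ i))\<bar> \<ge> c * real q powr - (r $ i)"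
    using assms[OF q, of "\<lambda>i. round (real q * x $ i)"] unfolding bad_box_def by (auto simp: not_less)
  have "\<bar>real q * x $ i - real_of_int (round (real q * x $ i))\<bar> \<le> infdist (real q * x $ i) \<int>"
    unfolding infdist_notempty[OF ex_in_conv[THEN iffD1, OF exI, OF Ints_0]]
  proof (rule cINF_greatest)
    fix z :: real
    assume "z \<in> \<int>"
    then obtain m where "z = real_of_int m" by (auto elim: Ints_cases)
    then show "\<bar>real q * x $ i - real_of_int (round (real q * x $ i))\<bar> \<le> dist (real q * x $ i) z"
      using round_diff_minimal[of "real q * x $ i" m] by (simp add: dist_real_def)
  qed auto
  then have "c * real q powr - (r $ i) \<le> infdist (real q * x $ i) \<int>" using i by linarith
  then have "c \<le> real q powr (r $ i) * infdist (real q * x $ i) \<int>"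
    using q by (simp add: powr_minus field_simps)
  also have "\<dots> \<le> (MAX i\<in>UNIV. real q powr (r $ i) * infdist (real q * x $ i) \<int>)"
    by (intro Max_ge) auto
  finally show "c \<le> (MAX i\<in>UNIV. real q powr (r $ i) * infdist (real q * x $ i) \<int>)" .
qed simp

text \<open>The last clause says, without division, that \<open>p / q\<close> lies on
  \<open>rational_hyperplane a b\<close>.\<close>

definition covector :: "real ^ 'n \<Rightarrow> nat \<Rightarrow> ('n \<Rightarrow> int) \<Rightarrow> ('n \<Rightarrow> int) \<Rightarrow> int \<Rightarrow> bool" where
  "covector r q p a b \<longleftrightarrow> 1 \<le> q \<and> (\<exists>i. a i \<noteq> 0) \<and>
    (\<forall>i. \<bar>real_of_int (a i)\<bar> \<le> real q powr (r $ i)) \<and> (\<Sum>i\<in>UNIV. a i * p i) + b * int q = 0"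

lemma covector_exists:
  assumes "(\<Sum>i\<in>UNIV. r $ i) = 1" "1 \<le> q"
  obtains a b where "covector r q p a b"
proof (rule exists_covector[OF assms, of p])
  fix a b
  assume "\<exists>i. a i \<noteq> 0" "\<And>i. \<bar>real_of_int (a i)\<bar> \<le> real q powr (r $ i)"
    "(\<Sum>i\<in>UNIV. a i * p i) + b * int q = 0"
  then show thesis using that[of a b] assms(2) unfolding covector_def by blast
qed

text \<open>Separates the approximation errors from an integer, \<open>q\<close> times the value of
  the form at \<open>p / q\<close>. Estimates of the other terms can then force this integer to
  vanish.\<close>

lemma affine_form_eq:
  fixes x :: "real ^ 'n"
  shows "real q * affine_form a b x = (\<Sum>i\<in>UNIV. real_of_int (a i) * (real q * x $ i - real_of_int (p i)))
    + real_of_int ((\<Sum>i\<in>UNIV. a i * p i) + b * int q)"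
proof -
  have "(\<Sum>i\<in>UNIV. real_of_int (a i) * (real q * x $ i - real_of_int (p i)))
      = real q * (\<Sum>i\<in>UNIV. real_of_int (a i) * x $ i) - (\<Sum>i\<in>UNIV. real_of_int (a i) * real_of_int (p i))"
    unfolding sum_distrib_left sum_subtractf[symmetric] by (intro sum.cong) (simp_all add: algebra_simps)
  then show ?thesis unfolding affine_form_def by (simp add: distrib_left)
qed

text \<open>As \<open>q1 \<le> q\<close>, the bound \<open>q1 powr r i\<close> on a coefficient
  times the bound \<open>c * q powr - (r i)\<close> on an error is at most \<open>c\<close>. A
  covector of one point can thus be tested on the boxes of all larger denominators.\<close>

lemma affine_form_bad_box:
  fixes x :: "real ^ 'n" and c :: real
  assumes a: "covector r q1 p1 a b" and q: "q1 \<le> q" and r0: "\<And>i. 0 \<le> r $ i"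
    and x: "x \<in> bad_box r c q p"
  shows "\<bar>real q * affine_form a b x - real_of_int ((\<Sum>i\<in>UNIV. a i * p i) + b * int q)\<bar> \<le> CARD('n) * c"
proof -
  have q1: "1 \<le> q1" using a unfolding covector_def by auto
  have "\<bar>\<Sum>i\<in>UNIV. real_of_int (a i) * (real q * x $ i - real_of_int (p i))\<bar> \<le> (\<Sum>i\<in>(UNIV::'n set). c)"
  proof (rule order_trans[OF sum_abs sum_mono])
    fix i
    have "real q1 powr (r $ i) \<le> real q powr (r $ i)"
      using q r0 by (intro powr_mono2) auto
    then have "\<bar>real_of_int (a i)\<bar> \<le> real q powr (r $ i)"
      using a unfolding covector_def by (meson order_trans)
    moreover have "\<bar>real q * x $ i - real_of_int (p i)\<bar> \<le> c * real q powr - (r $ i)"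
      using x unfolding bad_box_def by (auto intro: less_imp_le)
    ultimately have "\<bar>real_of_int (a i) * (real q * x $ i - real_of_int (p i))\<bar>
        \<le> real q powr (r $ i) * (c * real q powr - (r $ i))"
      unfolding abs_mult by (intro mult_mono) auto
    also have "\<dots> = c" using q q1 by (simp add: powr_minus)
    finally show "\<bar>real_of_int (a i) * (real q * x $ i - real_of_int (p i))\<bar> \<le> c" .
  qed
  then show ?thesis unfolding affine_form_eq[of q a b x p] by simp
qed

section \<open>Weights that agree up to one exception\<close>

definition height :: "nat \<Rightarrow> ('n::finite \<Rightarrow> int) \<Rightarrow> real" where
  "height q a = real q * max_coeff a"

text \<open>\<open>l\<close> is the one index whose weight may lie below the common value
  \<open>R\<close>. \<open>weight_half\<close> keeps the exponent of \<open>D\<close> in the bound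
  for coefficient \<open>l\<close> at \<open>11 / 16\<close>, below the \<open>3 / 4\<close> that an
  integer combination can absorb.\<close>

locale almost_equal_weights =
  fixes r :: "real ^ 'n" and l :: 'n and R :: real
  assumes weight_nonneg: "\<And>i. 0 \<le> r $ i"
    and weight_sum: "(\<Sum>i\<in>UNIV. r $ i) = 1"
    and weight_eq: "\<And>i. i \<noteq> l \<Longrightarrow> r $ i = R"
    and weight_le: "r $ l \<le> R"
    and weight_half: "r $ l \<le> 1 / 2"
    and R_le_1: "R \<le> 1"
begin

lemma R_nonneg: "0 \<le> R"
  using weight_nonneg[of l] weight_le by linarith

lemma weight_le_R: "r $ i \<le> R"
  using weight_eq[of i] weight_le by (cases "i = l") auto

abbreviation hroot :: "nat \<Rightarrow> ('n \<Rightarrow> int) \<Rightarrow> real" where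
  "hroot q a \<equiv> height q a powr (1 / (1 + R))"

text \<open>The factor by which \<open>q\<close> exceeds \<open>hroot\<close>; by
  \<open>max_coeff_eq\<close> the largest coefficient falls short of \<open>hroot powr R\<close> by
  the same factor.\<close>

definition flatness :: "nat \<Rightarrow> ('n \<Rightarrow> int) \<Rightarrow> real" where
  "flatness q a = real q / hroot q a"

section \<open>Size estimates for a single covector\<close>

context
  fixes q p a b
  assumes cov: "covector r q p a b"
begin

lemma q_ge_1: "1 \<le> real q"
  using cov unfolding covector_def by simp

lemma coeff_le: "\<bar>real_of_int (a i)\<bar> \<le> real q powr (r $ i)"
  using cov unfolding covector_def by blast

lemma nonzero: "\<exists>i. a i \<noteq> 0"
  using cov unfolding covector_def by blast

lemma coeff_ge_1: "1 \<le> max_coeff a"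
  by (rule max_coeff_ge_1[OF nonzero])

lemma max_coeff_le: "max_coeff a \<le> real q powr R"
proof -
  obtain i where "max_coeff a = \<bar>real_of_int (a i)\<bar>" by (rule max_coeff_attained)
  also have "\<dots> \<le> real q powr (r $ i)" by (rule coeff_le)
  also have "\<dots> \<le> real q powr R"
    using q_ge_1 weight_le_R by (intro powr_mono) auto
  finally show ?thesis .
qed

lemma height_ge_q: "real q \<le> height q a"
  using q_ge_1 coeff_ge_1 unfolding height_def by (simp add: mult_le_cancel_left1)

lemma height_ge_1: "1 \<le> height q a"
  using height_ge_q q_ge_1 by linarith

lemma height_le: "height q a \<le> real q powr (1 + R)"
proof -
  have "height q a \<le> real q * real q powr R"
    unfolding height_def using max_coeff_le by (intro mult_left_mono) auto
  then show ?thesis using q_ge_1 by (simp add: powr_add)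
qed

lemma hroot_ge_1: "1 \<le> hroot q a"
  using height_ge_1 R_nonneg by (intro ge_one_powr_ge_zero) auto

lemma hroot_powr: "hroot q a powr (1 + R) = height q a"
  using R_nonneg height_ge_1 by (simp add: powr_powr)

lemma q_eq: "real q = hroot q a * flatness q a"
  unfolding flatness_def using height_ge_1 by simp

lemma flatness_ge_1: "1 \<le> flatness q a"
proof -
  have "hroot q a \<le> (real q powr (1 + R)) powr (1 / (1 + R))"
    using height_le height_ge_1 R_nonneg by (intro powr_mono2) auto
  also have "\<dots> = real q" using q_ge_1 R_nonneg by (simp add: powr_powr)
  finally show ?thesis unfolding flatness_def using height_ge_1 by (simp add: le_divide_eq)
qed

lemma flatness_le_height: "flatness q a \<le> height q a"
proof -
  have "flatness q a \<le> real q"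
    unfolding flatness_def using hroot_ge_1 q_ge_1 by (simp add: divide_le_eq mult_le_cancel_left1)
  then show ?thesis using height_ge_q by linarith
qed

lemma max_coeff_eq: "max_coeff a = hroot q a powr R / flatness q a"
proof -
  have "real q * max_coeff a = hroot q a * hroot q a powr R"
    using hroot_powr hroot_ge_1 by (simp add: height_def powr_add)
  then show ?thesis
    using q_eq height_ge_1 flatness_ge_1 by (simp add: field_simps)
qed

text \<open>The largest coefficient is an integer of modulus at least 1, which caps the flatness
  through \<open>max_coeff_eq\<close>.\<close>

lemma flatness_le_hroot: "flatness q a \<le> hroot q a"
proof -
  have "flatness q a \<le> hroot q a powr R"
    using coeff_ge_1 flatness_ge_1 unfolding max_coeff_eq by (simp add: le_divide_eq)
  also have "\<dots> \<le> hroot q a powr 1"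
    using hroot_ge_1 R_le_1 by (intro powr_mono) auto
  finally show ?thesis using hroot_ge_1 by simp
qed

lemma affine_form_bad_box_own:
  fixes c :: real
  assumes "x \<in> bad_box r c q p"
  shows "\<bar>affine_form a b x\<bar> \<le> CARD('n) * c / real q"
proof -
  have "(\<Sum>i\<in>UNIV. a i * p i) + b * int q = 0" using cov unfolding covector_def by blast
  then have "real q * \<bar>affine_form a b x\<bar> \<le> CARD('n) * c"
    using affine_form_bad_box[OF cov order_refl weight_nonneg assms] q_ge_1 by (simp add: abs_mult)
  then show ?thesis using q_ge_1 by (simp add: field_simps)
qed

lemma hroot_bounds:
  assumes "0 < T" "1 \<le> G" "T powr (1 + R) \<le> height q a" "height q a \<le> T powr (1 + R) * G"
  shows "T \<le> hroot q a" "hroot q a \<le> T * G"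
proof -
  have T: "(T powr (1 + R)) powr (1 / (1 + R)) = T"
    using assms(1) R_nonneg by (simp add: powr_powr)
  show "T \<le> hroot q a"
    using assms R_nonneg by (subst T[symmetric], intro powr_mono2) auto
  have "hroot q a \<le> (T powr (1 + R) * G) powr (1 / (1 + R))"
    using assms R_nonneg height_ge_1 by (intro powr_mono2) auto
  also have "\<dots> = T * G powr (1 / (1 + R))"
    using assms T by (simp add: powr_mult)
  also have "\<dots> \<le> T * G powr 1"
    using assms R_nonneg by (intro mult_left_mono powr_mono) (auto simp: divide_le_eq_1)
  finally show "hroot q a \<le> T * G" using assms by simp
qed

text \<open>Here \<open>hroot\<close> lies between \<open>T\<close> and
  \<open>T * D powr (1 / 8)\<close>. Dividing by a flatness of at least \<open>D\<close> makes all
  coefficients small against \<open>T powr R\<close>. For coefficient \<open>l\<close> the covector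
  bound \<open>q powr r l\<close> is used instead, with \<open>q \<le> T * D powr (11 / 8)\<close>;
  it may exceed \<open>T powr r l\<close>, but only by a controlled power of
  \<open>D\<close>.\<close>

lemma flat_covector_bounds:
  assumes T: "0 < T" and D: "1 \<le> D" and G: "1 \<le> G" "G \<le> D powr (1 / 8)"
    and H: "T powr (1 + R) \<le> height q a" "height q a \<le> T powr (1 + R) * G"
    and F: "D \<le> flatness q a" "flatness q a \<le> D powr (5 / 4)"
  shows "1 \<le> T" "max_coeff a \<le> T powr R * D powr - (7 / 8)" "T * D \<le> real q"
    "\<bar>real_of_int (a l)\<bar> \<le> T powr (r $ l) * D powr (11 / 16)"
proof -
  note h = hroot_bounds[OF T G(1) H]
  have D8: "D powr (1 / 8) * D powr (7 / 8) = D"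
    using D by (simp flip: powr_add)
  have hT: "hroot q a \<le> T * D powr (1 / 8)"
    using h(2) G(2) T by (meson mult_left_mono order_trans less_imp_le)
  have "D powr (1 / 8) * D powr (7 / 8) \<le> D powr (1 / 8) * T"
    using F(1) flatness_le_hroot hT unfolding D8 by (simp add: mult.commute)
  then have "D powr (7 / 8) \<le> T" using D by simp
  moreover have "1 \<le> D powr (7 / 8)" using D by (intro ge_one_powr_ge_zero) auto
  ultimately show T1: "1 \<le> T" by linarith
  have "max_coeff a \<le> (T * D powr (1 / 8)) powr R / D"
    unfolding max_coeff_eq using hT hroot_ge_1 R_nonneg F(1) D
    by (intro frac_le powr_mono2) auto
  also have "\<dots> = T powr R * D powr (R / 8) / D"
    using T D by (simp add: powr_mult powr_powr)
  also have "\<dots> \<le> T powr R * D powr (1 / 8) / D"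
    using D R_le_1 by (intro divide_right_mono mult_left_mono powr_mono) auto
  also have "\<dots> = T powr R * D powr - (7 / 8)"
    using D D8 by (simp add: powr_minus field_simps)
  finally show "max_coeff a \<le> T powr R * D powr - (7 / 8)" .
  show "T * D \<le> real q"
    unfolding q_eq using h(1) F(1) T D by (intro mult_mono) auto
  have "real q \<le> (T * D powr (1 / 8)) * D powr (5 / 4)"
    unfolding q_eq using hT F T D by (intro mult_mono) auto
  also have "\<dots> = T * D powr (11 / 8)"
    using D by (simp flip: powr_add)
  finally have "real q powr (r $ l) \<le> (T * D powr (11 / 8)) powr (r $ l)"
    using weight_nonneg by (intro powr_mono2) auto
  also have "\<dots> = T powr (r $ l) * D powr (11 / 8 * r $ l)"
    using T D by (simp add: powr_mult powr_powr)
  also have "\<dots> \<le> T powr (r $ l) * D powr (11 / 16)"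
    using D weight_half by (intro mult_left_mono powr_mono) auto
  finally show "\<bar>real_of_int (a l)\<bar> \<le> T powr (r $ l) * D powr (11 / 16)"
    using coeff_le[of l] by linarith
qed

end

text \<open>The sum is an integer, \<open>q2\<close> times the value of the first form at
  \<open>p2 / q2\<close>. The first form is small at \<open>x1\<close>, hence at the nearby
  \<open>x2\<close>, and \<open>q2 \<le> E * q1\<close> keeps the product, errors included, below
  1.\<close>

lemma incidence:
  fixes c \<rho> E M :: real
  assumes cov: "covector r q1 p1 a1 b1" "covector r q2 p2 a2 b2" and q: "q1 \<le> q2"
    and x1: "x1 \<in> bad_box r c q1 p1" "dist y x1 \<le> \<rho>"
    and x2: "x2 \<in> bad_box r c q2 p2" "dist y x2 \<le> \<rho>"
    and E: "real q2 \<le> E * real q1" and M: "height q1 a1 * \<rho> \<le> M" and c: "0 \<le> c"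
    and small: "CARD('n) * (2 * M * E + c * E + c) < 1"
  shows "(\<Sum>i\<in>UNIV. a1 i * p2 i) + b1 * int q2 = 0"
proof -
  let ?z = "(\<Sum>i\<in>UNIV. a1 i * p2 i) + b1 * int q2"
  note q1 = q_ge_1[OF cov(1)]
  have \<rho>: "0 \<le> \<rho>" using x1(2) zero_le_dist[of y x1] by linarith
  have E0: "0 \<le> E" proof -
    have "0 < E * real q1" using E q_ge_1[OF cov(2)] by linarith
    then show ?thesis using q1 by (simp add: zero_less_mult_iff)
  qed
  have "\<bar>affine_form a1 b1 x2 - affine_form a1 b1 x1\<bar> \<le> CARD('n) * max_coeff a1 * dist x2 x1"
    by (rule affine_form_diff_le)
  also have "\<dots> \<le> CARD('n) * max_coeff a1 * (2 * \<rho>)"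
    using x1(2) x2(2) dist_triangle2[of x2 x1 y] coeff_ge_1[OF cov(1)]
    by (intro mult_left_mono) (auto simp: dist_commute)
  finally have "\<bar>affine_form a1 b1 x2\<bar> \<le> CARD('n) * max_coeff a1 * (2 * \<rho>) + CARD('n) * c / real q1"
    using affine_form_bad_box_own[OF cov(1) x1(1)] by linarith
  then have "real q2 * \<bar>affine_form a1 b1 x2\<bar>
      \<le> E * real q1 * (CARD('n) * max_coeff a1 * (2 * \<rho>) + CARD('n) * c / real q1)"
    using E by (intro mult_mono) auto
  also have "\<dots> = CARD('n) * (2 * (height q1 a1 * \<rho>) * E + c * E)"
    using q1 unfolding height_def by (simp add: field_simps)
  also have "\<dots> \<le> CARD('n) * (2 * M * E + c * E)"
    using M E0 by (intro mult_left_mono add_right_mono mult_right_mono) auto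
  finally have "\<bar>real q2 * affine_form a1 b1 x2\<bar> \<le> CARD('n) * (2 * M * E + c * E)"
    by (simp add: abs_mult)
  moreover have "\<bar>real q2 * affine_form a1 b1 x2 - real_of_int ?z\<bar> \<le> CARD('n) * c"
    by (rule affine_form_bad_box[OF cov(1) q weight_nonneg x2(1)])
  ultimately have "\<bar>real_of_int ?z\<bar> < 1"
    using small by (simp add: distrib_left)
  then show ?thesis by linarith
qed

text \<open>If the two hyperplanes differ, a small combination of the covectors transfers to a rational point
  of smaller height whose box contains the centre, contrary to \<open>avoid\<close>. It is here that the
  equality of all weights but one is needed.\<close>

lemma flat_hyperplanes_coincide:
  fixes c K \<rho> D G :: real
  assumes cov: "covector r q1 p1 a1 b1" "covector r q2 p2 a2 b2"
    and x1: "x1 \<in> bad_box r c q1 p1" "dist y x1 \<le> \<rho>"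
    and x2: "x2 \<in> bad_box r c q2 p2" "dist y x2 \<le> \<rho>"
    and \<rho>: "0 < \<rho>" and K: "0 < K" and c: "0 < c" "16 * real CARD('n) * c \<le> 1" "CARD('n) * (K + c) \<le> 1"
    and D: "1 \<le> D" "1 \<le> D powr (1 / 16) * c ^ (2 * CARD('n))"
    and G: "1 \<le> G" "G \<le> D powr (1 / 8)"
    and H1: "K / \<rho> \<le> height q1 a1" "height q1 a1 \<le> K / \<rho> * G"
    and H2: "K / \<rho> \<le> height q2 a2" "height q2 a2 \<le> K / \<rho> * G"
    and F1: "D \<le> flatness q1 a1" "flatness q1 a1 \<le> D powr (5 / 4)"
    and F2: "D \<le> flatness q2 a2" "flatness q2 a2 \<le> D powr (5 / 4)"
    and avoid: "\<And>q p a b. covector r q p a b \<Longrightarrow> height q a * \<rho> < K \<Longrightarrow> y \<notin> bad_box r c q p"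
  shows "rational_hyperplane a1 b1 = rational_hyperplane a2 b2"
proof (rule ccontr)
  assume neq: "rational_hyperplane a1 b1 \<noteq> rational_hyperplane a2 b2"
  define T where "T = (K / \<rho>) powr (1 / (1 + R))"
  have T0: "0 < T" unfolding T_def using K \<rho> by simp
  have TK: "T powr (1 + R) = K / \<rho>" unfolding T_def using K \<rho> R_nonneg by (simp add: powr_powr)
  note B1 = flat_covector_bounds[OF cov(1) T0 D(1) G H1[folded TK] F1]
  note B2 = flat_covector_bounds[OF cov(2) T0 D(1) G H2[folded TK] F2]
  note T1 = B1(1)
  have Dm: "D powr - (7 / 8) \<le> 1" using D(1) by (simp add: powr_minus inverse_le_1_iff ge_one_powr_ge_zero)
  \<comment> \<open>Two contributions: the value at \<open>x\<close> is small since \<open>x\<close>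
    is in the box of a denominator at least \<open>T * D\<close>, and the change from
    \<open>x\<close> to \<open>y\<close> is small since
    \<open>\<rho> = K / T powr (1 + R)\<close>.\<close>
  have yb: "\<bar>affine_form a b y\<bar> \<le> D powr - (7 / 8) / T"
    if cv: "covector r q p a b" and x: "x \<in> bad_box r c q p" "dist y x \<le> \<rho>"
      and A: "max_coeff a \<le> T powr R * D powr - (7 / 8)" and q: "T * D \<le> real q" for q p a b x
  proof -
    have \<rho>T: "\<rho> = K / (T * T powr R)"
      using TK T0 \<rho> K by (simp add: powr_add field_simps)
    have "\<bar>affine_form a b y - affine_form a b x\<bar> \<le> CARD('n) * max_coeff a * dist y x"
      by (rule affine_form_diff_le)
    also have "\<dots> \<le> CARD('n) * (T powr R * D powr - (7 / 8)) * \<rho>"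
      using A x(2) coeff_ge_1[OF cv] by (intro mult_mono mult_left_mono) auto
    also have "\<dots> = CARD('n) * K * D powr - (7 / 8) / T"
      unfolding \<rho>T using T0 by (simp add: field_simps)
    finally have 1: "\<bar>affine_form a b y - affine_form a b x\<bar> \<le> CARD('n) * K * D powr - (7 / 8) / T" .
    have "\<bar>affine_form a b x\<bar> \<le> CARD('n) * c / real q"
      by (rule affine_form_bad_box_own[OF cv x(1)])
    also have "\<dots> \<le> CARD('n) * c / (T * D)"
      using q T0 D(1) c q_ge_1[OF cv] by (intro divide_left_mono) auto
    also have "\<dots> = CARD('n) * c * D powr - 1 / T"
      using T0 D(1) by (simp add: powr_minus field_simps)
    also have "\<dots> \<le> CARD('n) * c * D powr - (7 / 8) / T"
      using T0 D(1) c by (intro divide_right_mono mult_left_mono powr_mono) auto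
    finally have "\<bar>affine_form a b x\<bar> \<le> CARD('n) * c * D powr - (7 / 8) / T" .
    then have "\<bar>affine_form a b y\<bar> \<le> CARD('n) * (K + c) * (D powr - (7 / 8) / T)"
      using 1 by (simp add: algebra_simps add_divide_distrib)
    also have "\<dots> \<le> 1 * (D powr - (7 / 8) / T)"
      using c(3) T0 by (intro mult_right_mono) auto
    finally show ?thesis by simp
  qed
  note y1 = yb[OF cov(1) x1 B1(2,3)] and y2 = yb[OF cov(2) x2 B2(2,3)]
  \<comment> \<open>Coefficient \<open>l\<close> drops from exponent \<open>11 / 16\<close> of
    \<open>D\<close> to \<open>- 1 / 16\<close>, while the other coefficients and the values at
    \<open>y\<close> rise only from \<open>- 7 / 8\<close> to \<open>- 1 / 8\<close>. All end up
    within \<open>\<eta>\<close>.\<close>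
  define N where "N = nat \<lceil>D powr (3 / 4)\<rceil>"
  have D34: "1 \<le> D powr (3 / 4)" using D(1) by (intro ge_one_powr_ge_zero) auto
  have N: "0 < N" "D powr (3 / 4) \<le> real N" "real N \<le> 2 * D powr (3 / 4)"
    using D34 unfolding N_def by linarith+
  obtain k h where kh: "(k, h) \<noteq> (0, 0)" "\<bar>k\<bar> \<le> int N" "\<bar>h\<bar> \<le> int N"
    "\<bar>real_of_int (k * a1 l + h * a2 l)\<bar> \<le> T powr (r $ l) * D powr (11 / 16) / real N"
    using small_integer_combination[OF B1(4) B2(4) N(1)] by blast
  define w where "w i = k * a1 i + h * a2 i" for i
  define b where "b = k * b1 + h * b2"
  define \<eta> where "\<eta> = 4 * D powr - (1 / 16)"
  have \<eta>0: "0 < \<eta>" unfolding \<eta>_def using D(1) by simp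
  have comb: "\<bar>real_of_int k * u + real_of_int h * v\<bar> \<le> \<eta> * S"
    if "\<bar>u\<bar> \<le> D powr - (7 / 8) * S" "\<bar>v\<bar> \<le> D powr - (7 / 8) * S" "0 \<le> S" for u v S
  proof -
    have "\<bar>real_of_int k\<bar> \<le> real N" "\<bar>real_of_int h\<bar> \<le> real N" using kh(2,3) by linarith+
    then have "\<bar>real_of_int k * u\<bar> \<le> real N * (D powr - (7 / 8) * S)"
      "\<bar>real_of_int h * v\<bar> \<le> real N * (D powr - (7 / 8) * S)"
      unfolding abs_mult using that by (auto intro!: mult_mono)
    then have "\<bar>real_of_int k * u + real_of_int h * v\<bar> \<le> 2 * real N * (D powr - (7 / 8) * S)"
      by linarith
    also have "\<dots> \<le> 2 * (2 * D powr (3 / 4)) * (D powr - (7 / 8) * S)"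
      using N(3) that(3) by (intro mult_right_mono) auto
    also have "\<dots> = 4 * D powr - (1 / 8) * S"
      using D(1) by (simp flip: powr_add)
    also have "\<dots> \<le> \<eta> * S"
      unfolding \<eta>_def using D(1) that(3) by (intro mult_right_mono mult_left_mono powr_mono) auto
    finally show ?thesis .
  qed
  have wi: "\<bar>real_of_int (w i)\<bar> \<le> \<eta> * T powr (r $ i)" for i
  proof (cases "i = l")
    case True
    have "\<bar>real_of_int (w l)\<bar> \<le> T powr (r $ l) * D powr (11 / 16) / real N"
      using kh(4) unfolding w_def .
    also have "\<dots> \<le> T powr (r $ l) * D powr (11 / 16) / D powr (3 / 4)"
      using N D34 D(1) by (intro divide_left_mono mult_pos_pos) auto
    also have "\<dots> = T powr (r $ l) * D powr - (1 / 16)"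
    proof -
      have "D powr (11 / 16) = D powr (3 / 4) * D powr - (1 / 16)"
        by (simp flip: powr_add)
      then show ?thesis using D(1) by simp
    qed
    also have "\<dots> \<le> \<eta> * T powr (r $ l)" unfolding \<eta>_def by simp
    finally show ?thesis using True by simp
  next
    case False
    have "\<bar>real_of_int k * real_of_int (a1 i) + real_of_int h * real_of_int (a2 i)\<bar> \<le> \<eta> * T powr R"
      using B1(2) B2(2) max_coeff_ge[of a1 i] max_coeff_ge[of a2 i]
      by (intro comb) (auto simp: mult.commute)
    then show ?thesis using weight_eq[OF False] unfolding w_def by simp
  qed
  have "\<bar>affine_form w b y\<bar> \<le> \<eta> / T"
  proof -
    have "\<bar>real_of_int k * affine_form a1 b1 y + real_of_int h * affine_form a2 b2 y\<bar> \<le> \<eta> * (1 / T)"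
      using y1 y2 T0 by (intro comb) auto
    then show ?thesis unfolding w_def b_def affine_form_combination by simp
  qed
  then have wy: "\<bar>(\<Sum>i\<in>UNIV. real_of_int (w i) * y $ i) + real_of_int b\<bar> \<le> \<eta> / T"
    unfolding affine_form_def .
  \<comment> \<open>A vanishing combination would make the forms proportional with nonzero factors,
    so the hyperplanes would be equal.\<close>
  have w0: "(\<exists>i. w i \<noteq> 0) \<or> b \<noteq> 0"
  proof (rule ccontr)
    assume "\<not> ?thesis"
    then have z: "w i = 0" "b = 0" for i by auto
    have f: "real_of_int k * affine_form a1 b1 x + real_of_int h * affine_form a2 b2 x = 0" for x
      using affine_form_combination[of k a1 h a2 b1 b2 x] z unfolding w_def b_def
      by (simp add: affine_form_def)
    have "k \<noteq> 0"
    proof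
      assume "k = 0"
      then have "h \<noteq> 0" "\<And>i. h * a2 i = 0" using kh(1) z(1) unfolding w_def by auto
      then show False using nonzero[OF cov(2)] by auto
    qed
    moreover have "h \<noteq> 0"
    proof
      assume "h = 0"
      then have "k \<noteq> 0" "\<And>i. k * a1 i = 0" using kh(1) z(1) unfolding w_def by auto
      then show False using nonzero[OF cov(1)] by auto
    qed
    ultimately have "affine_form a1 b1 x = 0 \<longleftrightarrow> affine_form a2 b2 x = 0" for x
      using f[of x] by (auto simp: add_eq_0_iff)
    then show False using neq unfolding rational_hyperplane_def by simp
  qed
  \<comment> \<open>The transference error becomes \<open>c / 2\<close> times the weight factor,
    strictly inside the box, and \<open>16 * CARD('n) * c \<le> 1\<close> becomes
    \<open>8 * c * c \<le> \<theta>\<close>.\<close>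
  define \<theta> where "\<theta> = c / (2 * CARD('n))"
  have d1: "(1::real) \<le> CARD('n)" by simp
  have "1 * c \<le> CARD('n) * c" using c(1) d1 by (intro mult_right_mono) auto
  then have c1: "c < 1" using c(1,2) by linarith
  have \<theta>: "0 < \<theta>" "\<theta> < 1" "\<theta> \<le> c / 2"
  proof -
    show "0 < \<theta>" using c(1) d1 unfolding \<theta>_def by simp
    show "\<theta> \<le> c / 2" unfolding \<theta>_def using c(1) d1 by (intro divide_left_mono) auto
    then show "\<theta> < 1" using c1 c(1) by linarith
  qed
  have \<theta>\<eta>: "2 ^ CARD('n) * \<eta> \<le> \<theta> ^ CARD('n)"
  proof -
    have "D powr - (1 / 16) \<le> c ^ (2 * CARD('n))"
      using D by (simp add: powr_minus inverse_eq_divide divide_le_eq mult.commute)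
    then have "2 ^ CARD('n) * \<eta> \<le> 2 ^ CARD('n) * (4 * c ^ (2 * CARD('n)))"
      unfolding \<eta>_def by (intro mult_left_mono) auto
    also have "\<dots> \<le> 2 ^ CARD('n) * (4 ^ CARD('n) * c ^ (2 * CARD('n)))"
      using c(1) self_le_power[of "4::real" "CARD('n)"] by (intro mult_left_mono mult_right_mono) auto
    also have "\<dots> = (8 * c * c) ^ CARD('n)"
      unfolding power_mult power_mult_distrib[symmetric] by (simp add: power2_eq_square mult.assoc)
    also have "\<dots> \<le> \<theta> ^ CARD('n)"
    proof (intro power_mono)
      have "(16 * real CARD('n) * c) * c \<le> 1 * c" using c by (intro mult_right_mono) auto
      then show "8 * c * c \<le> \<theta>"
        unfolding \<theta>_def using d1 by (simp add: le_divide_eq mult_ac)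
    qed (use c(1) in auto)
    finally show ?thesis .
  qed
  obtain q p where qp: "1 \<le> q" "real q \<le> \<theta> * T"
    "\<And>i. \<bar>real q * y $ i - real_of_int (p i)\<bar> \<le> CARD('n) * \<theta> * T powr - (r $ i)"
    using transference[OF weight_sum weight_nonneg T1 \<eta>0 \<theta>(1,2) \<theta>\<eta> w0 wi wy] by blast
  have "\<theta> * T < 1 * T" using \<theta>(2) T0 by (intro mult_strict_right_mono) auto
  then have qT: "real q < T" using qp(2) by linarith
  have "y \<in> bad_box r c q p"
    unfolding bad_box_def mem_Collect_eq
  proof
    fix i
    have "\<bar>real q * y $ i - real_of_int (p i)\<bar> \<le> c / 2 * T powr - (r $ i)"
      using qp(3)[of i] unfolding \<theta>_def by simp
    also have "\<dots> < c * T powr - (r $ i)" using c(1) T0 by simp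
    also have "\<dots> \<le> c * real q powr - (r $ i)"
      using qT qp(1) c(1) weight_nonneg[of i] by (intro mult_left_mono powr_mono2') auto
    finally show "\<bar>real q * y $ i - real_of_int (p i)\<bar> < c * real q powr - (r $ i)" .
  qed
  moreover obtain a b' where ab: "covector r q p a b'"
    by (rule covector_exists[OF weight_sum qp(1)])
  \<comment> \<open>Any covector of the new point will do: its height is at most
    \<open>q powr (1 + R)\<close>, and \<open>q < T\<close>.\<close>
  moreover have "height q a * \<rho> < K"
  proof -
    have "real q powr (1 + R) < K / \<rho>"
      unfolding TK[symmetric] using qT R_nonneg by (intro powr_less_mono2) auto
    then have "height q a < K / \<rho>" using height_le[OF ab] by linarith
    then show ?thesis using \<rho> by (simp add: field_simps)
  qed
  ultimately show False using avoid by blast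
qed

text \<open>\<open>\<Lambda>\<close> measures the flatness of a class on a logarithmic scale, and the class with parameter \<open>\<Lambda>\<close>
  waits for its turn while the radius shrinks by a factor no less than \<open>t powr (\<Lambda> / (160 * CARD('n)))\<close>. Up to
  \<open>\<Lambda> = 40 * CARD('n)\<close> incidence with the hyperplane of least denominator is forced; beyond, all
  hyperplanes coincide.\<close>

definition covers :: "real \<Rightarrow> real \<Rightarrow> real \<Rightarrow> real ^ 'n \<Rightarrow> real \<Rightarrow> (real ^ 'n) set \<Rightarrow> bool" where
  "covers \<beta> t \<Lambda> y \<rho> H \<longleftrightarrow> (\<forall>q p a b. covector r q p a b \<longrightarrow>
     t powr (- 4 * (\<Lambda> - 1)) \<le> flatness q a \<longrightarrow>
     flatness q a \<le> t powr (- 4 * (\<Lambda> * (1 + 1 / (320 * real CARD('n))) - 1)) \<longrightarrow>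
     t ^ 2 \<le> height q a * \<rho> \<longrightarrow> height q a * \<rho> \<le> t ^ 2 * t powr - (\<Lambda> / (160 * real CARD('n))) \<longrightarrow>
     bad_box r (t ^ 4) q p \<inter> cball y \<rho> \<subseteq> hyperplane_nbhd H (\<beta> * \<rho>))"

text \<open>If no box of the class meets the ball, any hyperplane serves. Otherwise the one of the
  least denominator does: for small \<open>\<Lambda>\<close> by \<open>incidence\<close>, since the
  denominators in the class are then comparable, and for large \<open>\<Lambda>\<close> by
  \<open>flat_hyperplanes_coincide\<close>.\<close>

lemma class_hyperplane:
  fixes t \<Lambda> \<beta> \<rho> :: real
  assumes t: "0 < t" "8 * real CARD('n) * t \<le> 1" "CARD('n) * t ^ 2 \<le> \<beta>"
    and \<Lambda>: "1 \<le> \<Lambda>" and \<rho>: "0 < \<rho>"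
    and avoid: "\<And>q p a b. covector r q p a b \<Longrightarrow> height q a * \<rho> < t ^ 2 \<Longrightarrow> bad_box r (t ^ 4) q p \<inter> cball y \<rho> = {}"
  shows "\<exists>H. hyperplane H \<and> covers \<beta> t \<Lambda> y \<rho> H"
proof -
  let ?d = "real CARD('n)"
  define Dlo where "Dlo = t powr (- 4 * (\<Lambda> - 1))"
  define Dhi where "Dhi = t powr (- 4 * (\<Lambda> * (1 + 1 / (320 * ?d)) - 1))"
  define G where "G = t powr - (\<Lambda> / (160 * ?d))"
  define ok where "ok q p a b \<longleftrightarrow> covector r q p a b \<and> Dlo \<le> flatness q a \<and> flatness q a \<le> Dhi \<and>
    t ^ 2 \<le> height q a * \<rho> \<and> height q a * \<rho> \<le> t ^ 2 * G \<and> bad_box r (t ^ 4) q p \<inter> cball y \<rho> \<noteq> {}" for q p a b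
  have covI: "covers \<beta> t \<Lambda> y \<rho> H"
    if "\<And>q p a b x. ok q p a b \<Longrightarrow> x \<in> bad_box r (t ^ 4) q p \<Longrightarrow> x \<in> cball y \<rho> \<Longrightarrow> infdist x H \<le> \<beta> * \<rho>" for H
    using that unfolding covers_def ok_def Dlo_def[symmetric] Dhi_def[symmetric] G_def[symmetric] hyperplane_nbhd_def
    by blast
  show ?thesis
  proof (cases "\<exists>q p a b. ok q p a b")
    case False
    have "hyperplane (rational_hyperplane (\<lambda>i::'n. 1) 0)" by (rule hyperplane_rational_hyperplane) simp
    then show ?thesis using covI False by blast
  next
    case True
    define q1 where "q1 = (LEAST q. \<exists>p a b. ok q p a b)"
    obtain p1 a1 b1 where ok1: "ok q1 p1 a1 b1"
      using LeastI_ex[OF True] unfolding q1_def by blast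
    have least: "q1 \<le> q" if "ok q p a b" for q p a b
      unfolding q1_def using that by (intro Least_le) blast
    have cov1: "covector r q1 p1 a1 b1" using ok1 unfolding ok_def by blast
    obtain x1 where x1: "x1 \<in> bad_box r (t ^ 4) q1 p1" "dist y x1 \<le> \<rho>"
      using ok1 unfolding ok_def by auto
    have d1: "1 \<le> ?d" by simp
    have "8 * 1 * t \<le> 8 * ?d * t" using t(1) d1 by (intro mult_right_mono) auto
    then have t1: "t \<le> 1 / 8" using t(2) by linarith
    have tm: "t powr u \<le> t powr v" if "v \<le> u" for u v
      using that t(1) t1 by (intro powr_mono') auto
    have G1: "1 \<le> G" using tm[of "- (\<Lambda> / (160 * ?d))" 0] t(1) \<Lambda> d1 unfolding G_def by simp
    have Dlo1: "1 \<le> Dlo" using tm[of "- 4 * (\<Lambda> - 1)" 0] t(1) \<Lambda> unfolding Dlo_def by simp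
    have "0 \<le> ?d * t ^ 2" by simp
    then have \<beta>0: "0 \<le> \<beta>" using t(3) by linarith
    have thin: "?d * t ^ 4 / real q / max_coeff a \<le> \<beta> * \<rho>"
      if "covector r q p a b" "t ^ 2 \<le> height q a * \<rho>" for q p a b
    proof -
      have h: "0 < height q a" using height_ge_1[OF that(1)] by linarith
      have "?d * t ^ 4 / real q / max_coeff a = ?d * t ^ 2 * (t ^ 2 / height q a)"
        unfolding height_def by (simp add: power_numeral_reduce)
      also have "\<dots> \<le> \<beta> * \<rho>"
        using that(2) t h \<beta>0 by (intro mult_mono) (auto simp: divide_le_eq mult.commute)
      finally show ?thesis .
    qed
    have "infdist x (rational_hyperplane a1 b1) \<le> \<beta> * \<rho>"
      if okq: "ok q p a b" and x: "x \<in> bad_box r (t ^ 4) q p" "x \<in> cball y \<rho>" for q p a b x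
    proof (cases "\<Lambda> \<le> 40 * ?d")
      case True
      have cov: "covector r q p a b" using okq unfolding ok_def by blast
      define T where "T = (t ^ 2 / \<rho>) powr (1 / (1 + R))"
      have T0: "0 < T" unfolding T_def using t(1) \<rho> by simp
      have TK: "T powr (1 + R) = t ^ 2 / \<rho>" unfolding T_def using t(1) \<rho> R_nonneg by (simp add: powr_powr)
      have "T \<le> hroot q1 a1" "hroot q a \<le> T * G"
        using hroot_bounds[OF cov1 T0 G1] hroot_bounds[OF cov T0 G1] ok1 okq \<rho>
        unfolding TK ok_def by (auto simp: field_simps)
      then have "T * Dlo \<le> real q1" "real q \<le> T * G * Dhi"
        unfolding q_eq[OF cov1] q_eq[OF cov] using ok1 okq T0 Dlo1 G1 flatness_ge_1[OF cov] unfolding ok_def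
        by (auto intro!: mult_mono)
      \<comment> \<open>\<open>G * Dhi / Dlo\<close> equals
        \<open>t powr - (3 * \<Lambda> / (160 * CARD('n)))\<close>, and \<Lambda> is at most
        \<open>40 * CARD('n)\<close>.\<close>
      moreover have "G * Dhi \<le> t powr - (3 / 4) * Dlo"
      proof -
        have "\<Lambda> / ?d \<le> 40" using True d1 by (simp add: divide_le_eq)
        then have "t powr (- (\<Lambda> / (160 * ?d)) + (- 4 * (\<Lambda> * (1 + 1 / (320 * ?d)) - 1))) \<le> t powr (- (3 / 4) + (- 4 * (\<Lambda> - 1)))"
          by (intro tm) (simp add: algebra_simps)
        then show ?thesis unfolding G_def Dhi_def Dlo_def powr_add .
      qed
      ultimately have E: "real q \<le> t powr - (3 / 4) * real q1"
      proof -
        assume 1: "T * Dlo \<le> real q1" and 2: "real q \<le> T * G * Dhi" and 3: "G * Dhi \<le> t powr - (3 / 4) * Dlo"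
        note 2
        also have "T * G * Dhi \<le> T * (t powr - (3 / 4) * Dlo)"
          using 3 T0 by (simp add: mult.assoc)
        also have "\<dots> \<le> t powr - (3 / 4) * real q1"
          using mult_left_mono[OF 1, of "t powr - (3 / 4)"] by (simp add: mult_ac)
        finally show ?thesis .
      qed
      have M: "height q1 a1 * \<rho> \<le> t powr (7 / 4)"
      proof -
        have "\<Lambda> / (160 * ?d) \<le> 1 / 4" using True d1 by (simp add: divide_le_eq)
        then have "G \<le> t powr - (1 / 4)" unfolding G_def by (intro tm) simp
        then have "t ^ 2 * G \<le> t powr 2 * t powr - (1 / 4)"
          using t(1) by (auto intro!: mult_mono)
        also have "\<dots> = t powr (7 / 4)" by (simp flip: powr_add)
        finally show ?thesis using ok1 unfolding ok_def by linarith
      qed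
      \<comment> \<open>With \<open>M = t powr (7 / 4)\<close> and
        \<open>E = t powr - (3 / 4)\<close> the product \<open>2 * M * E\<close> is
        \<open>2 * t\<close>, and each of the two terms with \<open>t ^ 4\<close> is at most
        \<open>t\<close>.\<close>
      have "(\<Sum>i\<in>UNIV. a1 i * p i) + b1 * int q = 0"
      proof (rule incidence[OF cov1 cov least[OF okq] x1 x(1) _ E M])
        show "dist y x \<le> \<rho>" using x(2) by simp
        have t4: "t ^ 4 = t powr 4" using t(1) by simp
        have "2 * t powr (7 / 4) * t powr - (3 / 4) = 2 * t"
          using t(1) by (simp flip: powr_add)
        moreover have "t ^ 4 * t powr - (3 / 4) \<le> t"
          using tm[of 1 "4 + - (3 / 4)"] t(1) unfolding t4 powr_add by simp
        moreover have "t ^ 4 \<le> t"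
          using tm[of 1 4] t(1) unfolding t4 by simp
        ultimately have "?d * (2 * t powr (7 / 4) * t powr - (3 / 4) + t ^ 4 * t powr - (3 / 4) + t ^ 4) \<le> ?d * (4 * t)"
          by (intro mult_left_mono) auto
        then show "?d * (2 * t powr (7 / 4) * t powr - (3 / 4) + t ^ 4 * t powr - (3 / 4) + t ^ 4) < 1"
          using t(2) by linarith
      qed (use t(1) in auto)
      then have "real q * \<bar>affine_form a1 b1 x\<bar> \<le> ?d * t ^ 4"
        using affine_form_bad_box[OF cov1 least[OF okq] weight_nonneg x(1)] by (simp add: abs_mult)
      then have "\<bar>affine_form a1 b1 x\<bar> \<le> ?d * t ^ 4 / real q"
        using q_ge_1[OF cov] by (simp add: field_simps)
      also have "\<dots> \<le> ?d * t ^ 4 / real q1"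
        using least[OF okq] q_ge_1[OF cov1] t(1) by (intro divide_left_mono) auto
      finally have "\<bar>affine_form a1 b1 x\<bar> / max_coeff a1 \<le> ?d * t ^ 4 / real q1 / max_coeff a1"
        using coeff_ge_1[OF cov1] by (intro divide_right_mono) auto
      also have "\<dots> \<le> \<beta> * \<rho>" using thin[OF cov1] ok1 unfolding ok_def by blast
      finally show ?thesis
        using infdist_rational_hyperplane_le[OF nonzero[OF cov1], of x b1] by linarith
    next
      case False
      have cov: "covector r q p a b" using okq unfolding ok_def by blast
      have "rational_hyperplane a1 b1 = rational_hyperplane a b"
      proof (rule flat_hyperplanes_coincide[OF cov1 cov x1 x(1) _ \<rho>, where K = "t ^ 2" and D = Dlo and G = G])
        show "dist y x \<le> \<rho>" using x(2) by simp
        have t4: "t ^ 4 \<le> t" "t ^ 2 \<le> t"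
          using power_decreasing[of 1 4 t] power_decreasing[of 1 2 t] t(1) t1 by auto
        have "t ^ 4 \<le> t ^ 2 / 64"
          using mult_left_mono[of "t^2" "(1/8)^2" "t^2"] power_mono[OF t1, of 2] t(1) by (simp add: power_numeral_reduce)
        then have "16 * ?d * t ^ 4 \<le> 16 * ?d * (t / 64)"
          using t4(2) by (intro mult_left_mono) auto
        moreover have "0 < ?d * t" using t(1) by simp
        ultimately show "16 * ?d * t ^ 4 \<le> 1" using t(2) by linarith
        have "?d * (t ^ 2 + t ^ 4) \<le> ?d * (2 * t)" using t4 by (intro mult_left_mono) auto
        then show "?d * (t ^ 2 + t ^ 4) \<le> 1" using t(2) \<open>0 < ?d * t\<close> by linarith
        \<comment> \<open>The required
          \<open>1 \<le> Dlo powr (1 / 16) * t powr (8 * CARD('n))\<close> amounts to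
          \<open>8 * CARD('n) \<le> (\<Lambda> - 1) / 4\<close>.\<close>
        have "32 * ?d + 1 \<le> \<Lambda>" using False d1 by linarith
        then have "t powr 0 \<le> t powr ((- 4 * (\<Lambda> - 1)) * (1 / 16) + 8 * ?d)"
          by (intro tm) (simp add: field_simps)
        also have "\<dots> = Dlo powr (1 / 16) * (t ^ 4) ^ (2 * CARD('n))"
        proof -
          have "(t ^ 4) ^ (2 * CARD('n)) = t powr real (4 * (2 * CARD('n)))"
            by (simp only: powr_realpow[OF t(1)] power_mult)
          then show ?thesis unfolding Dlo_def powr_powr powr_add by simp
        qed
        finally show "1 \<le> Dlo powr (1 / 16) * (t ^ 4) ^ (2 * CARD('n))" using t(1) by simp
        have \<Lambda>40: "40 \<le> \<Lambda>" using False d1 by linarith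
        have key1: "- 4 * (\<Lambda> - 1) * (1 / 8) \<le> - z" if "z \<le> \<Lambda> / 160" for z
          using that \<Lambda>40 by simp
        have key2: "- 4 * (\<Lambda> - 1) * (5 / 4) \<le> - 4 * (\<Lambda> + z - 1)" if "z \<le> \<Lambda> / 320" for z
          using that \<Lambda>40 by simp
        have "\<Lambda> / (160 * ?d) \<le> \<Lambda> / 160" using d1 \<Lambda> by (intro divide_left_mono) auto
        then show "G \<le> Dlo powr (1 / 8)"
          unfolding G_def Dlo_def powr_powr using key1 by (intro tm) blast
        have "\<Lambda> / (320 * ?d) \<le> \<Lambda> / 320" using d1 \<Lambda> by (intro divide_left_mono) auto
        moreover have "\<Lambda> * (1 + 1 / (320 * ?d)) = \<Lambda> + \<Lambda> / (320 * ?d)"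
          by (simp add: distrib_left)
        ultimately have "Dhi \<le> Dlo powr (5 / 4)"
          unfolding Dhi_def Dlo_def powr_powr using key2[of "\<Lambda> / (320 * ?d)"] by (intro tm) simp
        then show "flatness q1 a1 \<le> Dlo powr (5 / 4)" "flatness q a \<le> Dlo powr (5 / 4)"
          using ok1 okq unfolding ok_def by linarith+
        show "y \<notin> bad_box r (t ^ 4) q' p'" if "covector r q' p' a' b'" "height q' a' * \<rho> < t ^ 2" for q' p' a' b'
          using avoid[OF that] \<rho> by auto
      qed (use ok1 okq t(1) \<rho> G1 Dlo1 in \<open>auto simp: ok_def field_simps\<close>)
      moreover have "\<bar>affine_form a b x\<bar> / max_coeff a \<le> ?d * t ^ 4 / real q / max_coeff a"
        using affine_form_bad_box_own[OF cov x(1)] coeff_ge_1[OF cov] by (intro divide_right_mono) auto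
      moreover have "\<dots> \<le> \<beta> * \<rho>" using thin[OF cov] okq unfolding ok_def by blast
      ultimately show ?thesis
        using infdist_rational_hyperplane_le[OF nonzero[OF cov], of x b] by simp
    qed
    then show ?thesis
      using covI hyperplane_rational_hyperplane[OF nonzero[OF cov1]] by blast
  qed
qed

end

text \<open>The inner ball lies on one side of a hyperplane through the outer centre. Its point
  \<open>x\<close> farthest from the hyperplane is at least a diameter away from it, yet within
  \<open>\<rho>\<close> of the centre.\<close>

lemma central_hyperplane_halves:
  fixes y z e :: "'a::euclidean_space"
  assumes e: "norm e = 1" and s: "0 \<le> s"
    and sub: "cball z s \<subseteq> cball y \<rho>" and disj: "cball z s \<inter> {x. e \<bullet> x = e \<bullet> y} = {}"
  shows "2 * s \<le> \<rho>"
proof -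
  define u where "u = e \<bullet> (z - y)"
  have ee: "e \<bullet> e = 1" using e by (simp add: dot_square_norm)
  have "z - u *\<^sub>R e \<in> {x. e \<bullet> x = e \<bullet> y}"
    using ee unfolding u_def by (simp add: inner_diff_right)
  then have "z - u *\<^sub>R e \<notin> cball z s" using disj by blast
  then have us: "s < \<bar>u\<bar>" using e by (simp add: dist_norm)
  define x where "x = z + (sgn u * s) *\<^sub>R e"
  have "x \<in> cball z s" using e s unfolding x_def by (simp add: dist_norm abs_mult abs_sgn_eq)
  then have "x \<in> cball y \<rho>" using sub by blast
  then have "norm (x - y) \<le> \<rho>" by (simp add: dist_norm norm_minus_commute)
  moreover have "\<bar>e \<bullet> (x - y)\<bar> \<le> norm (x - y)"
    using Cauchy_Schwarz_ineq2[of e "x - y"] e by simp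
  moreover have "e \<bullet> (x - y) = u + sgn u * s"
    using ee unfolding x_def u_def by (simp add: inner_diff_right inner_add_right)
  ultimately show ?thesis using us s by (auto simp: sgn_if split: if_splits)
qed

section \<open>The strategy\<close>

context almost_equal_weights
begin

text \<open>The ratio of the parameters \<open>\<Lambda>\<close> of consecutive classes. It is the
  factor in the upper flatness bound of \<open>covers\<close>, so the flatness intervals
  abut.\<close>

definition growth :: real where
  "growth = 1 + 1 / (320 * real CARD('n))"

text \<open>The least class whose upper bound admits \<open>F\<close> works; the lower bound of
  class 0 is 1.\<close>

lemma flatness_class:
  assumes t: "0 < t" "t < 1" and F: "1 \<le> F"
  obtains \<kappa> where "t powr (- 4 * (growth ^ \<kappa> - 1)) \<le> F" "F \<le> t powr (- 4 * (growth ^ Suc \<kappa> - 1))"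
proof -
  define P where "P \<kappa> \<longleftrightarrow> F \<le> t powr (- 4 * (growth ^ Suc \<kappa> - 1))" for \<kappa>
  have g: "1 < growth" unfolding growth_def by simp
  obtain k where k: "1 - ln F / (4 * ln t) < growth ^ k"
    using real_arch_pow[OF g] by blast
  have "growth ^ k \<le> growth ^ Suc k" using g by (intro power_increasing) auto
  then have "1 - ln F / (4 * ln t) \<le> growth ^ Suc k" using k by linarith
  then have "ln F \<le> - 4 * (growth ^ Suc k - 1) * ln t"
    using t by (simp add: field_simps)
  then have "F \<le> exp (- 4 * (growth ^ Suc k - 1) * ln t)"
    using F exp_le_cancel_iff[of "ln F"] by simp
  then have "P k" unfolding P_def powr_def using t by simp
  define \<kappa> where "\<kappa> = (LEAST \<kappa>. P \<kappa>)"
  have P\<kappa>: "P \<kappa>" unfolding \<kappa>_def using \<open>P k\<close> by (rule LeastI)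
  show thesis
  proof (rule that)
    show "F \<le> t powr (- 4 * (growth ^ Suc \<kappa> - 1))" using P\<kappa> unfolding P_def .
    show "t powr (- 4 * (growth ^ \<kappa> - 1)) \<le> F"
    proof (cases \<kappa>)
      case 0
      then show ?thesis using F t by simp
    next
      case (Suc m)
      then have "\<not> P m" using not_less_Least[of m P] unfolding \<kappa>_def by simp
      then show ?thesis unfolding P_def Suc by simp
    qed
  qed
qed

text \<open>In even rounds Alice deletes the hyperplane covering the class whose turn it is. In odd rounds
  she deletes a hyperplane through the centre, which makes the radii tend to \<open>0\<close>.\<close>

text \<open>The exponent is \<open>8 * N * 160 * CARD('n)\<close> for \<open>N = 320 * CARD('n)\<close>, since a turn comes within
  \<open>4 * N * growth ^ \<kappa>\<close> pairs of rounds.\<close>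

definition scale_parameter :: "real \<Rightarrow> real \<Rightarrow> real" where
  "scale_parameter \<beta> \<rho> = min \<rho> (\<beta> ^ (409600 * CARD('n) ^ 2) / (8 * real CARD('n)))"

text \<open>\<open>length h - 1\<close> is the index of the current round. Only Bob's first radius
  enters \<open>t\<close>, so \<open>t\<close> is constant along a play. The central hyperplane is
  also the default when no good one exists.\<close>

definition alice_hyperplane :: "(nat \<Rightarrow> nat) \<Rightarrow> real \<Rightarrow> (real ^ 'n) bob_move list \<Rightarrow> (real ^ 'n) set" where
  "alice_hyperplane cls \<beta> h =
    (let n = length h - 1; y = fst (last h); \<rho> = snd (last h); t = scale_parameter \<beta> (snd (hd h));
         good = (\<lambda>H. hyperplane H \<and> covers \<beta> t (growth ^ cls (n div 2)) y \<rho> H)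
     in if even n \<and> (\<exists>H. good H) then SOME H. good H else {x. axis l 1 \<bullet> x = axis l 1 \<bullet> y})"

definition alice_strategy :: "(nat \<Rightarrow> nat) \<Rightarrow> real \<Rightarrow> (real ^ 'n) strategy" where
  "alice_strategy cls \<beta> h = (alice_hyperplane cls \<beta> h, \<beta> * snd (last h))"

lemma legal_alice_strategy:
  assumes "0 < \<beta>"
  shows "legal_strategy \<beta> (alice_strategy cls \<beta>)"
proof -
  have "hyperplane {x :: real ^ 'n. axis l 1 \<bullet> x = axis l 1 \<bullet> y}" for y
    unfolding hyperplane_def by (intro exI[of _ "axis l 1"] exI[of _ "axis l 1 \<bullet> y"]) (simp add: axis_eq_0_iff)
  then have "hyperplane (alice_hyperplane cls \<beta> h)" for h
    unfolding alice_hyperplane_def Let_def by (auto intro: someI2_ex)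
  then show ?thesis
    unfolding legal_strategy_def alice_strategy_def using assms by auto
qed

section \<open>Analysis of a fixed legal play\<close>

context
  fixes cls :: "nat \<Rightarrow> nat" and \<beta> :: real and B :: "nat \<Rightarrow> (real ^ 'n) bob_move"
  assumes \<beta>: "0 < \<beta>" "\<beta> < 1"
    and cls: "\<And>\<kappa> i. \<exists>j>i. real j \<le> real i + 1280 * real CARD('n) * growth ^ \<kappa> \<and> cls j = \<kappa>"
    and play: "legal_play \<beta> (alice_strategy cls \<beta>) B"
begin

abbreviation "\<rho> n \<equiv> snd (B n)"
abbreviation "t \<equiv> scale_parameter \<beta> (\<rho> 0)"

lemma radius_pos: "0 < \<rho> n"
  using play unfolding legal_play_def by blast

lemma radius_ge: "\<beta> * \<rho> n \<le> \<rho> (Suc n)"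
  using play unfolding legal_play_def by blast

lemma reply: "alice_reply (alice_strategy cls \<beta>) B n = (alice_hyperplane cls \<beta> (map B [0..<Suc n]), \<beta> * \<rho> n)"
  unfolding alice_reply_def alice_strategy_def by simp

lemma ball_step:
  "ball_of (B (Suc n)) \<subseteq> ball_of (B n) - hyperplane_nbhd (alice_hyperplane cls \<beta> (map B [0..<Suc n])) (\<beta> * \<rho> n)"
  using play unfolding legal_play_def reply by auto

lemma ball_antimono: "m \<le> n \<Longrightarrow> ball_of (B n) \<subseteq> ball_of (B m)"
  by (induction n rule: dec_induct) (use ball_step in blast)+

lemma radius_antimono: "m \<le> n \<Longrightarrow> \<rho> n \<le> \<rho> m"
  using ball_antimono[of m n] radius_pos[of n] zero_le_dist[of "fst (B n)" "fst (B m)"]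
  unfolding ball_of_def cball_subset_cball_iff by linarith

lemma radius_halves:
  assumes "odd n"
  shows "2 * \<rho> (Suc n) \<le> \<rho> n"
proof (rule central_hyperplane_halves)
  let ?H = "{x :: real ^ 'n. axis l 1 \<bullet> x = axis l 1 \<bullet> fst (B n)}"
  have "alice_hyperplane cls \<beta> (map B [0..<Suc n]) = ?H"
    unfolding alice_hyperplane_def Let_def using assms by simp
  moreover have "?H \<subseteq> hyperplane_nbhd ?H (\<beta> * \<rho> n)"
    unfolding hyperplane_nbhd_def using \<beta> radius_pos[of n] by (auto simp: mult_nonneg_nonneg)
  ultimately show "cball (fst (B (Suc n))) (\<rho> (Suc n)) \<inter> ?H = {}"
    using ball_step[of n] unfolding ball_of_def by auto
  show "cball (fst (B (Suc n))) (\<rho> (Suc n)) \<subseteq> cball (fst (B n)) (\<rho> n)"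
    using ball_step[of n] unfolding ball_of_def by auto
  show "0 \<le> \<rho> (Suc n)" using radius_pos[of "Suc n"] by simp
qed simp

lemma radius_even_le: "\<rho> (2 * i) \<le> \<rho> 0 / 2 ^ i"
proof (induction i)
  case (Suc i)
  have "2 * \<rho> (2 * Suc i) \<le> \<rho> (2 * i)"
    using radius_halves[of "Suc (2 * i)"] radius_antimono[of "2 * i" "Suc (2 * i)"] by simp
  then show ?case using Suc.IH by simp
qed simp

lemma radius_power_le: "\<beta> ^ k * \<rho> n \<le> \<rho> (n + k)"
proof (induction k)
  case (Suc k)
  have "\<beta> ^ Suc k * \<rho> n = \<beta> * (\<beta> ^ k * \<rho> n)" by simp
  also have "\<dots> \<le> \<beta> * \<rho> (n + k)" using Suc.IH \<beta> by (intro mult_left_mono) auto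
  also have "\<dots> \<le> \<rho> (n + Suc k)" using radius_ge[of "n + k"] by simp
  finally show ?case .
qed simp

lemma t_bounds:
  shows "0 < t" "t \<le> \<rho> 0" "8 * real CARD('n) * t \<le> 1" "real CARD('n) * t ^ 2 \<le> \<beta>" "t < 1"
    "t \<le> \<beta> ^ (409600 * CARD('n) ^ 2)"
proof -
  let ?d = "real CARD('n)" and ?m = "409600 * CARD('n) ^ 2"
  have d1: "1 \<le> ?d" by simp
  show t0: "0 < t" unfolding scale_parameter_def using radius_pos \<beta> by simp
  show "t \<le> \<rho> 0" unfolding scale_parameter_def by simp
  have "t \<le> \<beta> ^ ?m / (8 * ?d)" unfolding scale_parameter_def by simp
  then have td: "8 * ?d * t \<le> \<beta> ^ ?m" by (simp add: field_simps)
  have \<beta>m: "\<beta> ^ ?m \<le> \<beta> ^ 1" using \<beta> by (intro power_decreasing) (auto simp: Suc_le_eq)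
  show t8: "8 * ?d * t \<le> 1" using td \<beta>m \<beta> by simp
  have "1 * t \<le> ?d * t" using t0 d1 by (intro mult_right_mono) auto
  then show t1: "t < 1" "t \<le> \<beta> ^ ?m" using td t8 t0 by linarith+
  have "?d * t * t \<le> ?d * t * 1" using t0 t1 by (intro mult_left_mono) auto
  then have "?d * t ^ 2 \<le> ?d * t" by (simp add: power2_eq_square mult.assoc)
  moreover have "0 < ?d * t" using t0 by simp
  ultimately show "?d * t ^ 2 \<le> \<beta>" using td \<beta>m unfolding power_one_right by linarith
qed

lemma growth_ge_1: "1 \<le> growth ^ \<kappa>"
  unfolding growth_def by (intro one_le_power) simp

text \<open>A wait of \<open>j - i\<close> turns lasts \<open>2 * (j - i)\<close> rounds, each
  costing at most a factor \<open>\<beta>\<close>. The exponent in \<open>scale_parameter\<close>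
  lets the power of \<open>t\<close> absorb this loss.\<close>

lemma slot_radius:
  assumes "real j \<le> real i + 1280 * real CARD('n) * growth ^ \<kappa>" "i \<le> j"
  shows "t powr (growth ^ \<kappa> / (160 * real CARD('n))) * \<rho> (2 * i) \<le> \<rho> (2 * j)"
proof -
  let ?d = "real CARD('n)"
  let ?u = "growth ^ \<kappa> / (160 * ?d)"
  have u: "0 \<le> ?u" using growth_ge_1[of \<kappa>] by simp
  define m where "m = 409600 * CARD('n) ^ 2"
  have "t powr ?u \<le> (\<beta> ^ m) powr ?u"
    unfolding m_def using t_bounds u by (intro powr_mono2) auto
  also have "\<dots> = \<beta> powr (real m * ?u)"
    unfolding powr_realpow[OF \<beta>(1), symmetric] powr_powr ..
  also have "real m * ?u = 2560 * ?d * growth ^ \<kappa>"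
    unfolding m_def by (simp add: power2_eq_square)
  also have "\<beta> powr (2560 * ?d * growth ^ \<kappa>) \<le> \<beta> powr real (2 * (j - i))"
    using assms \<beta> by (intro powr_mono') (auto simp: of_nat_diff)
  also have "\<dots> = \<beta> ^ (2 * (j - i))" by (rule powr_realpow[OF \<beta>(1)])
  finally have "t powr ?u * \<rho> (2 * i) \<le> \<beta> ^ (2 * (j - i)) * \<rho> (2 * i)"
    using radius_pos[of "2 * i"] by (intro mult_right_mono) auto
  also have "\<dots> \<le> \<rho> (2 * i + 2 * (j - i))" by (rule radius_power_le)
  also have "2 * i + 2 * (j - i) = 2 * j" using assms(2) by simp
  finally show ?thesis .
qed

text \<open>The box is deleted at the last turn \<open>j\<close> of its class with
  \<open>t ^ 2 \<le> height q a * \<rho> (2 * j)\<close>. The next turn comes soon enough to bound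
  this product from above as well, so the box is among those covered. The induction hypothesis at
  \<open>j\<close> is the avoidance that \<open>class_hyperplane\<close> demands.\<close>

lemma even_balls_avoid:
  assumes "covector r q p a b" "height q a * \<rho> (2 * i) < t ^ 2"
  shows "bad_box r (t ^ 4) q p \<inter> ball_of (B (2 * i)) = {}"
  using assms
proof (induction i arbitrary: q p a b rule: less_induct)
  case (less i)
  note cov = less.prems(1)
  let ?d = "real CARD('n)"
  obtain \<kappa> where \<kappa>: "t powr (- 4 * (growth ^ \<kappa> - 1)) \<le> flatness q a"
    "flatness q a \<le> t powr (- 4 * (growth ^ Suc \<kappa> - 1))"
    using flatness_class[OF t_bounds(1,5) flatness_ge_1[OF cov]] by blast
  define J where "J = {j. cls j = \<kappa> \<and> t ^ 2 \<le> height q a * \<rho> (2 * j)}"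
  have h: "1 \<le> height q a" by (rule height_ge_1[OF cov])
  have Ji: "j < i" if "j \<in> J" for j
  proof (rule ccontr)
    assume "\<not> j < i"
    then have "height q a * \<rho> (2 * j) \<le> height q a * \<rho> (2 * i)"
      using h by (intro mult_left_mono radius_antimono) auto
    then show False using that less.prems(2) unfolding J_def by auto
  qed
  have "finite J" using Ji by (meson finite_lessThan finite_subset lessThan_iff subsetI)
  \<comment> \<open>The first turn of the class is early enough: a flat class waits longer, but its
    points have height at least their flatness.\<close>
  have "J \<noteq> {}"
  proof -
    obtain j where j: "real j \<le> real 0 + 1280 * ?d * growth ^ \<kappa>" "cls j = \<kappa>"
      using cls[of 0 \<kappa>] by blast
    let ?L = "growth ^ \<kappa>"
    have "?L / (160 * ?d) \<le> ?L / 1"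
    proof (intro divide_left_mono)
      have "1 \<le> ?d" by simp
      then show "1 \<le> 160 * ?d" by linarith
    qed (use growth_ge_1[of \<kappa>] in auto)
    then have "t powr 2 \<le> t powr (- 4 * (?L - 1) + ?L / (160 * ?d) + 1)"
      using t_bounds growth_ge_1[of \<kappa>] by (intro powr_mono') auto
    also have "\<dots> = t powr (- 4 * (?L - 1)) * (t powr (?L / (160 * ?d)) * t)"
      unfolding powr_add using t_bounds by simp
    also have "\<dots> \<le> height q a * (t powr (?L / (160 * ?d)) * \<rho> (2 * 0))"
      using \<kappa>(1) flatness_le_height[OF cov] t_bounds h by (intro mult_mono) auto
    also have "\<dots> \<le> height q a * \<rho> (2 * j)"
      using slot_radius[OF j(1)] h by (intro mult_left_mono) auto
    finally have "t ^ 2 \<le> height q a * \<rho> (2 * j)" using t_bounds by simp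
    then show ?thesis using j(2) unfolding J_def by blast
  qed
  define j where "j = Max J"
  have j: "j \<in> J" unfolding j_def using \<open>finite J\<close> \<open>J \<noteq> {}\<close> by (rule Max_in)
  then have cj: "cls j = \<kappa>" "t ^ 2 \<le> height q a * \<rho> (2 * j)" unfolding J_def by auto
  obtain j' where j': "j < j'" "real j' \<le> real j + 1280 * ?d * growth ^ \<kappa>" "cls j' = \<kappa>"
    using cls[of j \<kappa>] by blast
  have "j' \<notin> J" using Max_ge[OF \<open>finite J\<close>, of j'] j'(1) unfolding j_def by auto
  then have "height q a * \<rho> (2 * j') < t ^ 2" using j'(3) unfolding J_def by auto
  moreover have "height q a * (t powr (growth ^ \<kappa> / (160 * ?d)) * \<rho> (2 * j)) \<le> height q a * \<rho> (2 * j')"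
    using slot_radius[OF j'(2)] j'(1) h by (intro mult_left_mono) auto
  ultimately have "height q a * \<rho> (2 * j) * t powr (growth ^ \<kappa> / (160 * ?d)) \<le> t ^ 2"
    by (simp add: mult_ac)
  then have up: "height q a * \<rho> (2 * j) \<le> t ^ 2 * t powr - (growth ^ \<kappa> / (160 * ?d))"
    using t_bounds(1) by (simp add: powr_minus field_simps)
  let ?H = "alice_hyperplane cls \<beta> (map B [0..<Suc (2 * j)])"
  have "\<exists>H. hyperplane H \<and> covers \<beta> t (growth ^ \<kappa>) (fst (B (2 * j))) (\<rho> (2 * j)) H"
    using less.IH[OF Ji[OF j]] unfolding ball_of_def
    by (intro class_hyperplane t_bounds growth_ge_1 radius_pos) blast
  then have "covers \<beta> t (growth ^ \<kappa>) (fst (B (2 * j))) (\<rho> (2 * j)) ?H"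
    unfolding alice_hyperplane_def Let_def using cj(1)
    by (simp add: hd_map del: upt_Suc) (rule someI2_ex, auto)
  then have "bad_box r (t ^ 4) q p \<inter> ball_of (B (2 * j)) \<subseteq> hyperplane_nbhd ?H (\<beta> * \<rho> (2 * j))"
    using cov \<kappa>(1) \<kappa>(2)[unfolded power_Suc2] cj(2) up
    unfolding covers_def ball_of_def growth_def[symmetric] by blast
  then have "bad_box r (t ^ 4) q p \<inter> ball_of (B (Suc (2 * j))) = {}"
    using ball_step[of "2 * j"] by blast
  then show ?case
    using ball_antimono[of "Suc (2 * j)" "2 * i"] Ji[OF j] by fastforce
qed

text \<open>The radii tend to 0, so every height eventually falls under
  \<open>even_balls_avoid\<close>. A common point of the balls lies in no box and is bad with
  constant \<open>t ^ 4\<close>.\<close>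

lemma play_meets_Bad: "(\<Inter>n. ball_of (B n)) \<inter> Bad r \<noteq> {}"
proof -
  have "(\<Inter>n. ball_of (B n)) \<noteq> {}"
  proof (rule compact_nest)
    show "compact (ball_of (B n))" "ball_of (B n) \<noteq> {}" for n
      unfolding ball_of_def using radius_pos[of n] by simp_all
  qed (rule ball_antimono)
  then obtain x where x: "\<And>n. x \<in> ball_of (B n)" by blast
  have "x \<in> Bad_eps (t ^ 4) r"
  proof (rule Bad_eps_if_avoids_boxes)
    fix q p
    assume "1 \<le> (q :: nat)"
    then obtain a b where cov: "covector r q p a b"
      using covector_exists[OF weight_sum] by metis
    have h: "1 \<le> height q a" by (rule height_ge_1[OF cov])
    have "(\<lambda>i. height q a * (\<rho> 0 / 2 ^ i)) \<longlonglongrightarrow> 0"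
      by (intro tendsto_mult_right_zero LIMSEQ_divide_realpow_zero) simp
    then have "eventually (\<lambda>i. height q a * (\<rho> 0 / 2 ^ i) < t ^ 2) sequentially"
      using t_bounds(1) by (intro order_tendstoD(2)) auto
    then obtain i where "height q a * (\<rho> 0 / 2 ^ i) < t ^ 2"
      by (auto dest: eventually_happens)
    moreover have "height q a * \<rho> (2 * i) \<le> height q a * (\<rho> 0 / 2 ^ i)"
      using radius_even_le h by (intro mult_left_mono) auto
    ultimately show "x \<notin> bad_box r (t ^ 4) q p"
      using even_balls_avoid[OF cov, of i] x by fastforce
  qed
  then have "x \<in> Bad r" unfolding Bad_def using t_bounds(1) by (intro UN_I[of "t ^ 4"]) auto
  then show ?thesis using x by blast
qed

end

lemma HAW_Bad: "HAW (Bad r)"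
  unfolding HAW_def
proof
  fix \<beta> :: real
  assume "\<beta> \<in> {0<..<1/3}"
  then have \<beta>: "0 < \<beta>" "\<beta> < 1" by auto
  \<comment> \<open>With \<open>N = 320 * CARD('n)\<close> the ratio \<open>1 + 1 / N\<close> is
    \<open>growth\<close> and \<open>4 * N\<close> is \<open>1280 * CARD('n)\<close>.\<close>
  obtain cls :: "nat \<Rightarrow> nat" where
    "\<And>\<kappa> i. \<exists>j>i. real j \<le> real i + 4 * real (320 * CARD('n)) * (1 + 1 / real (320 * CARD('n))) ^ \<kappa> \<and> cls j = \<kappa>"
    using class_schedule[of "320 * CARD('n)"] by (auto simp: Suc_le_eq)
  then have cls: "\<exists>j>i. real j \<le> real i + 1280 * real CARD('n) * growth ^ \<kappa> \<and> cls j = \<kappa>" for \<kappa> i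
    unfolding growth_def by simp
  show "beta_HAW \<beta> (Bad r)"
    unfolding beta_HAW_def using legal_alice_strategy[OF \<beta>(1)] play_meets_Bad[OF \<beta> cls] by blast
qed

end

theorem theorem1p5:
  fixes r :: "real ^ 'n"
  assumes "CARD('n) \<ge> 2"
    and "\<And>i. r $ i \<ge> 0"
    and "(\<Sum>i\<in>UNIV. r $ i) = 1"
    and "card {i. r $ i = (MAX j\<in>UNIV. r $ j)} \<ge> CARD('n) - 1"
  shows "HAW (Bad r)"
proof -
  define R where "R = (MAX j\<in>UNIV. r $ j)"
  define M where "M = {i. r $ i = R}"
  have le: "r $ i \<le> R" for i unfolding R_def by (intro Max_ge) auto
  have "card (UNIV - M) \<le> 1"
    using assms(4) unfolding M_def R_def by (subst card_Diff_subset) auto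
  \<comment> \<open>If all weights agree, \<open>l\<close> is an arbitrary index.\<close>
  then obtain l where l: "UNIV - M \<subseteq> {l}"
    using card_le_Suc0_iff_eq[of "UNIV - M"] by (metis One_nat_def finite insertI1 subsetI singletonI)
  have eq: "r $ i = R" if "i \<noteq> l" for i using l that unfolding M_def by auto
  \<comment> \<open>In dimension at least 2 some other index carries the weight \<open>R\<close>, so
    \<open>r l + R \<le> 1\<close>; with \<open>r l \<le> R\<close> this gives
    \<open>r l \<le> 1 / 2\<close>.\<close>
  have "card {l} < CARD('n)" using assms(1) by simp
  then obtain k where k: "k \<noteq> l" by (metis UNIV_I card_seteq finite insert_iff less_irrefl singletonD subsetI top_unique)
  have "r $ l + r $ k = (\<Sum>i\<in>{l, k}. r $ i)" using k by simp
  also have "\<dots> \<le> 1" unfolding assms(3)[symmetric] using assms(2) by (intro sum_mono2) auto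
  finally have "r $ l + R \<le> 1" using eq[OF k] by simp
  then have "R \<le> 1" "r $ l \<le> 1 / 2" using le[of l] assms(2)[of l] by linarith+
  then have "almost_equal_weights r l R"
    using assms(2,3) eq le[of l] by unfold_locales auto
  then show ?thesis by (rule almost_equal_weights.HAW_Bad)
qed

end
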